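(* Let $\Gamma\vdash M:\sigma$ and $\Gamma\vdash M':\sigma$ be terms of $\mathsf{pPCF}$. If $[\![M]\!]_\Gamma=[\![M']\!]_\Gamma$ then $M$ and $M'$ are observationally equivalent.
   Context: Syntax of probabilistic PCF ($\mathsf{pPCF}$). Types: $\sigma,\tau::=\mathtt{nat}\mid \sigma\Rightarrow\tau$. Terms: $M::=\underline{n}\ (n\in\mathbb N)\mid x\mid \mathtt{succ}(M)\mid \mathtt{if}(M,P,z\cdot R)\mid \lambda x^{\sigma}M\mid (M)N\mid \mathtt{coin}(p)\ (p\in[0,1]\cap\mathbb Q)\mid \mathtt{fix}(M)$. A typing context $\Gamma=(x_1:\sigma_1,\dots,x_k:\sigma_k)$ has pairwise distinct variables. Typing rules: $\Gamma\vdash\underline n:\mathtt{nat}$; $\Gamma\vdash x_i:\sigma_i$; $\Gamma\vdash\mathtt{coin}(p):\mathtt{nat}$; if $\Gamma\vdash M:\mathtt{nat}$ then $\Gamma\vdash\mathtt{succ}(M):\mathtt{nat}$; if $\Gamma\vdash M:\mathtt{nat}$, $\Gamma\vdash P:\sigma$, $\Gamma,z:\mathtt{nat}\vdash R:\sigma$ then $\Gamma\vdash\mathtt{if}(M,P,z\cdot R):\sigma$; if $\Gamma,x:\sigma\vdash M:\tau$ then $\Gamma\vdash\lambda x^\sigma M:\sigma\Rightarrow\tau$; if $\Gamma\vdash M:\sigma\Rightarrow\tau$ and $\Gamma\vdash N:\sigma$ then $\Gamma\vdash (M)N:\tau$; if $\Gamma\vdash M:\sigma\Rightarrow\sigma$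 then $\Gamma\vdash\mathtt{fix}(M):\sigma$. $M[N/x]$ is substitution. Reduction. One-step reduction $M\to_p M'$: $(\lambda x^\sigma M)N\to_1 M[N/x]$; $\mathtt{fix}(M)\to_1 (M)\mathtt{fix}(M)$; $\mathtt{succ}(\underline n)\to_1\underline{n+1}$; $\mathtt{if}(\underline 0,P,z\cdot R)\to_1 P$; $\mathtt{if}(\underline{n+1},P,z\cdot R)\to_1 R[\underline n/z]$; $\mathtt{coin}(p)\to_p\underline 0$; $\mathtt{coin}(p)\to_{1-p}\underline 1$; and if $M\to_p M'$ then $(M)N\to_p(M')N$, $\mathtt{succ}(M)\to_p\mathtt{succ}(M')$, $\mathtt{if}(M,P,z\cdot R)\to_p\mathtt{if}(M',P,z\cdot R)$. $M$ is weak-normal if it has no reduction. For a countable set $I$ and a stochastic matrix $S$, let $I_1=\{i: S_{i,i}=1\}$ and $S^\infty_{i,j}=\sup_n (S^n)_{i,j}$ if $j\in I_1$, $0$ otherwise. $\Lambda_\sigma$ is the set of closed terms of type $\sigma$ and $\mathrm{Red}_\sigma$ the matrix indexed by $\Lambda_\sigma$ with $(\mathrm{Red}_\sigma)_{M,M'}=p$ if $M\to_pM'$, $=1$ if $M$ is weak-normal and $M'=M$, $=0$ otherwise. Observational equivalence. Observation contexts are terms that may contain holes $[\ ]^{\Delta\vdash\tau}$, typed by the same rules plus $\Gamma',\Delta\vdash[\ ]^{\Delta\vdash\tau}:\tau$; $C[M]$ is $C$ with all holes filled by $M$ (free variables of $M$ may be captured). $M,M'$ with $\Gamma\vdash M,M':\sigma$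 are observationally equivalent if for every closed observation context $C$ of type $\mathtt{nat}$ with holes $[\ ]^{\Gamma\vdash\sigma}$, $(\mathrm{Red}_{\mathtt{nat}})^\infty_{C[M],\underline 0}=(\mathrm{Red}_{\mathtt{nat}})^\infty_{C[M'],\underline 0}$. Semantics. For countable $I$ and $u,u'\in[0,\infty)^I$, $\langle u,u'\rangle=\sum_i u_iu'_i$; $\mathcal X^\perp=\{u':\forall u\in\mathcal X,\ \langle u,u'\rangle\le1\}$. A PCS is $X=(|X|,\mathsf PX)$ with $|X|$ countable, $\mathsf PX\subseteq[0,\infty)^{|X|}$, $\mathsf PX^{\perp\perp}=\mathsf PX$, and for each $a$ some $u\in\mathsf PX$ with $u_a>0$ and $\sup_{u\in\mathsf PX}u_a<\infty$; ordered pointwise. $\mathcal M_{\mathrm{fin}}(A)$: finite multisets on $A$; $u^\mu=\prod_a u_a^{\mu(a)}$. $|[\![\mathtt{nat}]\!]|=\mathbb N$, $\mathsf P[\![\mathtt{nat}]\!]=\{u:\sum_nu_n\le1\}$; $|[\![\sigma\Rightarrow\tau]\!]|=\mathcal M_{\mathrm{fin}}(|[\![\sigma]\!]|)\times|[\![\tau]\!]|$, $\mathsf P[\![\sigma\Rightarrow\tau]\!]=\{t:\forall u\in\mathsf P[\![\sigma]\!],\ \hat t(u):=(\sum_\mu t_{(\mu,b)}u^\mu)_{b}\in\mathsf P[\![\tau]\!]\}$. For $\Gamma=(x_1:\sigma_1,\dots,x_k:\sigma_k)\vdash M:\sigma$, $[\![M]\!]_\Gamma$ is a nonnegative family indexed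 by $\mathcal M_{\mathrm{fin}}(|[\![\sigma_1]\!]|)\times\cdots\times\mathcal M_{\mathrm{fin}}(|[\![\sigma_k]\!]|)\times|[\![\sigma]\!]|$, determined by its function $\widehat{[\![M]\!]_\Gamma}(\vec u)=(\sum_{\vec\mu}([\![M]\!]_\Gamma)_{(\vec\mu,b)}u_1^{\mu_1}\cdots u_k^{\mu_k})_b$ from $\prod_i\mathsf P[\![\sigma_i]\!]$ to $\mathsf P[\![\sigma]\!]$, which is given by ($e_n$ the Dirac vector at $n$): $x_i\mapsto u_i$; $\underline n\mapsto e_n$; $\mathtt{coin}(p)\mapsto pe_0+(1-p)e_1$; $\mathtt{succ}(P)\mapsto\sum_n \hat P(\vec u)_ne_{n+1}$; $\mathtt{if}(P,Q,z\cdot R)\mapsto \hat P(\vec u)_0\hat Q(\vec u)+\sum_n\hat P(\vec u)_{n+1}\hat R(\vec u,e_n)$; $\lambda x^\sigma P\mapsto$ the $t$ with $\hat t(v)=\hat P(\vec u,v)$; $(P)Q\mapsto\hat t(\hat Q(\vec u))$, $t=\hat P(\vec u)$; $\mathtt{fix}(P)\mapsto\sup_n f^n(0)$ with $f=\hat t$, $t=\hat P(\vec u)$. *)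

theory Defs
  imports
    "HOL-Library.Multiset"
    "HOL-Library.Extended_Nonnegative_Real"
    "HOL-Analysis.Infinite_Sum"
begin

section \<open>Syntax of pPCF\<close>

text \<open>
  Terms are taken up to renaming of bound variables, using de Bruijn indices. The typing
  context $(x_1:\sigma_1,\dots,x_k:\sigma_k)$ is the list $[\sigma_k,\dots,\sigma_1]$, and
  \<open>Var i\<close> is $x_{k-i}$; so extending a context on the right is \<open>Cons\<close>, and the
  context $\Gamma',\Delta$ is \<open>\<Delta> @ \<Gamma>'\<close>. \<open>Lam\<close> binds index 0 in its
  body and \<open>Ifz M P R\<close> binds index 0 in \<open>R\<close>.
\<close>

datatype ty = TNat | TFun ty ty

datatype tm =
    Num nat
  | Var nat
  | Succ tm
  | Ifz tm tm tm
  | Lam ty tm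
  | App tm tm
  | Coin rat
  | Fix tm

text \<open>The restriction of the coin parameter to $[0,1]$ is enforced by the typing rules.\<close>

inductive typing :: "ty list \<Rightarrow> tm \<Rightarrow> ty \<Rightarrow> bool"  ("_ \<turnstile> _ : _" [50, 50, 50] 50) where
  T_Num: "\<Gamma> \<turnstile> Num n : TNat"
| T_Var: "i < length \<Gamma> \<Longrightarrow> \<Gamma> ! i = \<sigma> \<Longrightarrow> \<Gamma> \<turnstile> Var i : \<sigma>"
| T_Coin: "0 \<le> p \<Longrightarrow> p \<le> 1 \<Longrightarrow> \<Gamma> \<turnstile> Coin p : TNat"
| T_Succ: "\<Gamma> \<turnstile> M : TNat \<Longrightarrow> \<Gamma> \<turnstile> Succ M : TNat"
| T_Ifz: "\<Gamma> \<turnstile> M : TNat \<Longrightarrow> \<Gamma> \<turnstile> P : \<sigma> \<Longrightarrow> TNat # \<Gamma> \<turnstile> R : \<sigma> \<Longrightarrow> \<Gamma> \<turnstile> Ifz M P R : \<sigma>"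
| T_Lam: "\<sigma> # \<Gamma> \<turnstile> M : \<tau> \<Longrightarrow> \<Gamma> \<turnstile> Lam \<sigma> M : TFun \<sigma> \<tau>"
| T_App: "\<Gamma> \<turnstile> M : TFun \<sigma> \<tau> \<Longrightarrow> \<Gamma> \<turnstile> N : \<sigma> \<Longrightarrow> \<Gamma> \<turnstile> App M N : \<tau>"
| T_Fix: "\<Gamma> \<turnstile> M : TFun \<sigma> \<sigma> \<Longrightarrow> \<Gamma> \<turnstile> Fix M : \<sigma>"

text \<open>Types are unique, since abstractions carry the type of their variable.\<close>

definition type_of :: "ty list \<Rightarrow> tm \<Rightarrow> ty" where
  "type_of \<Gamma> M = (THE \<sigma>. \<Gamma> \<turnstile> M : \<sigma>)"

definition closed_terms :: "ty \<Rightarrow> tm set" where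
  "closed_terms \<sigma> = {M. [] \<turnstile> M : \<sigma>}"

primrec lift :: "tm \<Rightarrow> nat \<Rightarrow> tm" where
  "lift (Num n) k = Num n"
| "lift (Var i) k = (if i < k then Var i else Var (Suc i))"
| "lift (Succ M) k = Succ (lift M k)"
| "lift (Ifz M P R) k = Ifz (lift M k) (lift P k) (lift R (Suc k))"
| "lift (Lam \<sigma> M) k = Lam \<sigma> (lift M (Suc k))"
| "lift (App M N) k = App (lift M k) (lift N k)"
| "lift (Coin p) k = Coin p"
| "lift (Fix M) k = Fix (lift M k)"

text \<open>
  \<open>subst M N k\<close> substitutes \<open>N\<close> for index \<open>k\<close> in \<open>M\<close>; the binder of \<open>k\<close> disappears, so
  larger indices are decremented.
\<close>

primrec subst :: "tm \<Rightarrow> tm \<Rightarrow> nat \<Rightarrow> tm" where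
  "subst (Num n) N k = Num n"
| "subst (Var i) N k = (if k < i then Var (i - 1) else if i = k then N else Var i)"
| "subst (Succ M) N k = Succ (subst M N k)"
| "subst (Ifz M P R) N k = Ifz (subst M N k) (subst P N k) (subst R (lift N 0) (Suc k))"
| "subst (Lam \<sigma> M) N k = Lam \<sigma> (subst M (lift N 0) (Suc k))"
| "subst (App M M') N k = App (subst M N k) (subst M' N k)"
| "subst (Coin p) N k = Coin p"
| "subst (Fix M) N k = Fix (subst M N k)"


section \<open>Probabilistic reduction\<close>

inductive step :: "tm \<Rightarrow> rat \<Rightarrow> tm \<Rightarrow> bool" where
  step_beta: "step (App (Lam \<sigma> M) N) 1 (subst M N 0)"
| step_fix: "step (Fix M) 1 (App M (Fix M))"
| step_succ: "step (Succ (Num n)) 1 (Num (Suc n))"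
| step_if_0: "step (Ifz (Num 0) P R) 1 P"
| step_if_Suc: "step (Ifz (Num (Suc n)) P R) 1 (subst R (Num n) 0)"
| step_coin_0: "step (Coin p) p (Num 0)"
| step_coin_1: "step (Coin p) (1 - p) (Num 1)"
| step_App: "step M p M' \<Longrightarrow> step (App M N) p (App M' N)"
| step_Succ: "step M p M' \<Longrightarrow> step (Succ M) p (Succ M')"
| step_Ifz: "step M p M' \<Longrightarrow> step (Ifz M P R) p (Ifz M' P R)"

definition weak_normal :: "tm \<Rightarrow> bool" where
  "weak_normal M \<longleftrightarrow> \<not> (\<exists>p M'. step M p M')"

text \<open>
  Matrices indexed by \<open>I\<close> are functions of which only the entries in \<open>I \<times> I\<close> are used.
\<close>

primrec mat_pow :: "'a set \<Rightarrow> ('a \<Rightarrow> 'a \<Rightarrow> ennreal) \<Rightarrow> nat \<Rightarrow> 'a \<Rightarrow> 'a \<Rightarrow> ennreal" where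
  "mat_pow I S 0 = (\<lambda>i j. if i = j then 1 else 0)"
| "mat_pow I S (Suc n) = (\<lambda>i j. \<Sum>\<^sub>\<infinity>k\<in>I. S i k * mat_pow I S n k j)"

definition stationary :: "'a set \<Rightarrow> ('a \<Rightarrow> 'a \<Rightarrow> ennreal) \<Rightarrow> 'a set" where
  "stationary I S = {i \<in> I. S i i = 1}"

definition mat_inf :: "'a set \<Rightarrow> ('a \<Rightarrow> 'a \<Rightarrow> ennreal) \<Rightarrow> 'a \<Rightarrow> 'a \<Rightarrow> ennreal" where
  "mat_inf I S i j = (if j \<in> stationary I S then (SUP n. mat_pow I S n i j) else 0)"

text \<open>
  For given \<open>M\<close> and \<open>M'\<close> there is at most one \<open>p\<close> with \<open>step M p M'\<close>. The entries do not
  depend on the type; \<open>Red\<close> at type \<open>\<sigma>\<close> is this function on \<open>closed_terms \<sigma>\<close>.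
\<close>

definition Red :: "tm \<Rightarrow> tm \<Rightarrow> ennreal" where
  "Red M M' =
    (if \<exists>p. step M p M' then ennreal (of_rat (THE p. step M p M'))
     else if weak_normal M \<and> M' = M then 1
     else 0)"

definition Red_inf :: "ty \<Rightarrow> tm \<Rightarrow> tm \<Rightarrow> ennreal" where
  "Red_inf \<sigma> = mat_inf (closed_terms \<sigma>) Red"


section \<open>Observational equivalence\<close>

datatype octx =
    CHole
  | CNum nat
  | CVar nat
  | CSucc octx
  | CIfz octx octx octx
  | CLam ty octx
  | CApp octx octx
  | CCoin rat
  | CFix octx

text \<open>
  \<open>octyping \<Delta> \<tau> \<Gamma> C \<sigma>\<close>: in context \<open>\<Gamma>\<close>, the observation context \<open>C\<close> has type \<open>\<sigma>\<close>, all
  its holes being annotated with $\Delta\vdash\tau$.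
\<close>

inductive octyping :: "ty list \<Rightarrow> ty \<Rightarrow> ty list \<Rightarrow> octx \<Rightarrow> ty \<Rightarrow> bool"
  for \<Delta> :: "ty list" and \<tau> :: ty where
  C_Hole: "octyping \<Delta> \<tau> (\<Delta> @ \<Gamma>') CHole \<tau>"
| C_Num: "octyping \<Delta> \<tau> \<Gamma> (CNum n) TNat"
| C_Var: "i < length \<Gamma> \<Longrightarrow> \<Gamma> ! i = \<sigma> \<Longrightarrow> octyping \<Delta> \<tau> \<Gamma> (CVar i) \<sigma>"
| C_Coin: "0 \<le> p \<Longrightarrow> p \<le> 1 \<Longrightarrow> octyping \<Delta> \<tau> \<Gamma> (CCoin p) TNat"
| C_Succ: "octyping \<Delta> \<tau> \<Gamma> C TNat \<Longrightarrow> octyping \<Delta> \<tau> \<Gamma> (CSucc C) TNat"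
| C_Ifz: "octyping \<Delta> \<tau> \<Gamma> C TNat \<Longrightarrow> octyping \<Delta> \<tau> \<Gamma> D \<sigma> \<Longrightarrow> octyping \<Delta> \<tau> (TNat # \<Gamma>) E \<sigma> \<Longrightarrow>
    octyping \<Delta> \<tau> \<Gamma> (CIfz C D E) \<sigma>"
| C_Lam: "octyping \<Delta> \<tau> (\<sigma> # \<Gamma>) C \<sigma>' \<Longrightarrow> octyping \<Delta> \<tau> \<Gamma> (CLam \<sigma> C) (TFun \<sigma> \<sigma>')"
| C_App: "octyping \<Delta> \<tau> \<Gamma> C (TFun \<sigma> \<sigma>') \<Longrightarrow> octyping \<Delta> \<tau> \<Gamma> D \<sigma> \<Longrightarrow>
    octyping \<Delta> \<tau> \<Gamma> (CApp C D) \<sigma>'"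
| C_Fix: "octyping \<Delta> \<tau> \<Gamma> C (TFun \<sigma> \<sigma>) \<Longrightarrow> octyping \<Delta> \<tau> \<Gamma> (CFix C) \<sigma>"

text \<open>
  Filling does not lift \<open>M\<close>: the free variables of \<open>M\<close> are captured by the binders
  surrounding the hole.
\<close>

primrec fill :: "octx \<Rightarrow> tm \<Rightarrow> tm" where
  "fill CHole M = M"
| "fill (CNum n) M = Num n"
| "fill (CVar i) M = Var i"
| "fill (CSucc C) M = Succ (fill C M)"
| "fill (CIfz C D E) M = Ifz (fill C M) (fill D M) (fill E M)"
| "fill (CLam \<sigma> C) M = Lam \<sigma> (fill C M)"
| "fill (CApp C D) M = App (fill C M) (fill D M)"
| "fill (CCoin p) M = Coin p"
| "fill (CFix C) M = Fix (fill C M)"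

definition obs_equiv :: "ty list \<Rightarrow> ty \<Rightarrow> tm \<Rightarrow> tm \<Rightarrow> bool" where
  "obs_equiv \<Gamma> \<sigma> M M' \<longleftrightarrow>
    (\<forall>C. octyping \<Gamma> \<sigma> [] C TNat \<longrightarrow>
      Red_inf TNat (fill C M) (Num 0) = Red_inf TNat (fill C M') (Num 0))"


section \<open>Probabilistic coherence semantics\<close>

text \<open>
  The webs of all types live in one type of points. An element of $[0,\infty)^I$ is a
  function with values in \<^typ>\<open>ennreal\<close> that is finite everywhere and vanishes outside
  \<open>I\<close>; infinite sums, taken in $[0,\infty]$, may thus range over more indices than \<open>I\<close>.
\<close>

datatype pt = PNat nat | PFun "pt multiset" pt

type_synonym pvec = "pt \<Rightarrow> ennreal"

definition nonneg_families :: "'i set \<Rightarrow> ('i \<Rightarrow> ennreal) set" where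
  "nonneg_families I = {u. (\<forall>a. u a < \<infinity>) \<and> (\<forall>a. a \<notin> I \<longrightarrow> u a = 0)}"

primrec web :: "ty \<Rightarrow> pt set" where
  "web TNat = range PNat"
| "web (TFun \<sigma> \<tau>) = {PFun \<mu> b | \<mu> b. set_mset \<mu> \<subseteq> web \<sigma> \<and> b \<in> web \<tau>}"

definition mpow :: "pvec \<Rightarrow> pt multiset \<Rightarrow> ennreal" where
  "mpow u \<mu> = (\<Prod>a\<in>#\<mu>. u a)"

definition fun_hat :: "pvec \<Rightarrow> pvec \<Rightarrow> pvec" where
  "fun_hat t u = (\<lambda>b. \<Sum>\<^sub>\<infinity>\<mu>. t (PFun \<mu> b) * mpow u \<mu>)"

primrec pcliques :: "ty \<Rightarrow> pvec set" where
  "pcliques TNat = {u \<in> nonneg_families (web TNat). (\<Sum>\<^sub>\<infinity>n. u (PNat n)) \<le> 1}"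
| "pcliques (TFun \<sigma> \<tau>) =
    {t \<in> nonneg_families (web (TFun \<sigma> \<tau>)). \<forall>u\<in>pcliques \<sigma>. fun_hat t u \<in> pcliques \<tau>}"

type_synonym family = "pt multiset list \<times> pt \<Rightarrow> ennreal"

definition index :: "ty list \<Rightarrow> ty \<Rightarrow> (pt multiset list \<times> pt) set" where
  "index \<Gamma> \<sigma> = {(\<mu>s, b). list_all2 (\<lambda>\<mu> \<tau>. set_mset \<mu> \<subseteq> web \<tau>) \<mu>s \<Gamma> \<and> b \<in> web \<sigma>}"

definition envs :: "ty list \<Rightarrow> pvec list set" where
  "envs \<Gamma> = {us. list_all2 (\<lambda>u \<tau>. u \<in> pcliques \<tau>) us \<Gamma>}"

definition hat :: "family \<Rightarrow> pvec list \<Rightarrow> pvec" where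
  "hat F us =
    (\<lambda>b. \<Sum>\<^sub>\<infinity>\<mu>s\<in>{\<mu>s. length \<mu>s = length us}. F (\<mu>s, b) * prod_list (map2 mpow us \<mu>s))"

definition family_of :: "ty list \<Rightarrow> ty \<Rightarrow> (pvec list \<Rightarrow> pvec) \<Rightarrow> family" where
  "family_of \<Gamma> \<sigma> f =
    (THE F. F \<in> nonneg_families (index \<Gamma> \<sigma>) \<and> (\<forall>us\<in>envs \<Gamma>. hat F us = f us))"

definition dirac :: "nat \<Rightarrow> pvec" where
  "dirac n = (\<lambda>a. if a = PNat n then 1 else 0)"

text \<open>\<open>sem \<Gamma> M\<close> is meaningful only for terms that are typable in \<open>\<Gamma>\<close>.\<close>

fun sem :: "ty list \<Rightarrow> tm \<Rightarrow> family" where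
  "sem \<Gamma> (Var i) = family_of \<Gamma> (type_of \<Gamma> (Var i)) (\<lambda>us. us ! i)"
| "sem \<Gamma> (Num n) = family_of \<Gamma> (type_of \<Gamma> (Num n)) (\<lambda>us. dirac n)"
| "sem \<Gamma> (Coin p) = family_of \<Gamma> (type_of \<Gamma> (Coin p))
    (\<lambda>us a. ennreal (of_rat p) * dirac 0 a + ennreal (of_rat (1 - p)) * dirac 1 a)"
| "sem \<Gamma> (Succ P) = family_of \<Gamma> (type_of \<Gamma> (Succ P))
    (\<lambda>us a. \<Sum>\<^sub>\<infinity>n. hat (sem \<Gamma> P) us (PNat n) * dirac (n + 1) a)"
| "sem \<Gamma> (Ifz P Q R) = family_of \<Gamma> (type_of \<Gamma> (Ifz P Q R))
    (\<lambda>us a. hat (sem \<Gamma> P) us (PNat 0) * hat (sem \<Gamma> Q) us a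
      + (\<Sum>\<^sub>\<infinity>n. hat (sem \<Gamma> P) us (PNat (n + 1)) * hat (sem (TNat # \<Gamma>) R) (dirac n # us) a))"
| "sem \<Gamma> (Lam \<sigma> P) = family_of \<Gamma> (type_of \<Gamma> (Lam \<sigma> P))
    (\<lambda>us. THE t. t \<in> pcliques (type_of \<Gamma> (Lam \<sigma> P)) \<and>
      (\<forall>v\<in>pcliques \<sigma>. fun_hat t v = hat (sem (\<sigma> # \<Gamma>) P) (v # us)))"
| "sem \<Gamma> (App P Q) = family_of \<Gamma> (type_of \<Gamma> (App P Q))
    (\<lambda>us. fun_hat (hat (sem \<Gamma> P) us) (hat (sem \<Gamma> Q) us))"
| "sem \<Gamma> (Fix P) = family_of \<Gamma> (type_of \<Gamma> (Fix P))
    (\<lambda>us. SUP n. (fun_hat (hat (sem \<Gamma> P) us) ^^ n) (\<lambda>a. 0))"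

end

(*
  The interpretation is compositional, so [[M]] = [[M']] gives [[C[M]]] = [[C[M']]] for every context
  C; what remains is adequacy: a closed term N of type nat converges to n with probability exactly
  [[N]]_n. For "at most", one reduction step preserves the interpretation (as a convex combination),
  so every finite stage of Red^n is below [[N]]. For "at least", a logical relation between closed
  terms and cliques, which at type nat says that the clique is below the convergence probabilities,
  is closed under head expansion and under suprema of increasing sequences, hence contains all
  closed terms with their interpretations.

  That the families of the semantics exist and are unique needs an argument of its own. Uniqueness:
  the cliques of a type contain a small cube around 0 in every finite set of directions, where
  power series determine their coefficients. Existence: the interpretations are built by products,
  sums and compositions of power series, and a fixed point is the sum of the differences of
  successive iterates, which are again power series with nonnegative coefficients.
*)

theory Submission
  imports Defs "HOL-Complex_Analysis.Cauchy_Integral_Formula"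
begin

section \<open>Infinite sums of extended nonnegative reals\<close>

text \<open>\<open>sem\<close> is built from definite descriptions, which say nothing until
  existence and uniqueness are known at the actual arguments; so each semantic equation presupposes
  that the subterms already denote cliques. This is why a theory of power series precedes every
  statement about terms. It computes in [0,\<infinity>], where sums commute without hypotheses.
  Finiteness is recovered at the end, because a series that is finite at a clique positive on a
  multiset has a finite coefficient there. In the logical relation the obstacle is the conditional
  at a function type: its guard is random, but its result cannot be observed. The relation is
  therefore proved for all evaluation contexts at once, and a context absorbs arguments until the
  type is nat. Reduction starts from a closed term and contracts only closed redexes. Substitution
  is accordingly studied for closed arguments only, on which lifting is the identity.\<close>

lemma summable_on_ennreal': "(f :: 'a \<Rightarrow> ennreal) summable_on A"
  by (rule nonneg_summable_on_complete) simp

lemma infsum_ennreal_SUP: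
  "infsum (f :: 'a \<Rightarrow> ennreal) A = (SUP F\<in>{F. finite F \<and> F \<subseteq> A}. sum f F)"
  by (rule nonneg_infsum_complete) simp

lemma infsum_ennreal_mono:
  assumes "\<And>x. x \<in> A \<Longrightarrow> f x \<le> (g x :: ennreal)"
  shows "infsum f A \<le> infsum g A"
  by (rule infsum_mono) (auto simp: assms summable_on_ennreal')

lemma infsum_ennreal_add:
  "(\<Sum>\<^sub>\<infinity>x\<in>A. f x + (g x :: ennreal)) = infsum f A + infsum g A"
  by (rule infsum_add) (rule summable_on_ennreal')+

lemma infsum_ennreal_cmult: "(\<Sum>\<^sub>\<infinity>x\<in>A. c * (f x :: ennreal)) = c * infsum f A"
  unfolding infsum_ennreal_SUP
  by (subst SUP_mult_left_ennreal) (simp add: sum_distrib_left)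

lemma infsum_ennreal_multc: "(\<Sum>\<^sub>\<infinity>x\<in>A. f x * (c :: ennreal)) = infsum f A * c"
  using infsum_ennreal_cmult[of c f A] by (simp add: mult.commute)

lemma infsum_ennreal_sum:
  "finite F \<Longrightarrow> (\<Sum>\<^sub>\<infinity>y\<in>B. \<Sum>x\<in>F. f x y) = (\<Sum>x\<in>F. \<Sum>\<^sub>\<infinity>y\<in>B. (f x y :: ennreal))"
  by (induction F rule: finite_induct) (simp_all add: infsum_ennreal_add)

lemma sum_le_infsum_ennreal: "finite F \<Longrightarrow> F \<subseteq> A \<Longrightarrow> sum f F \<le> infsum (f :: 'a \<Rightarrow> ennreal) A"
  unfolding infsum_ennreal_SUP by (rule SUP_upper) auto

lemma elem_le_infsum_ennreal: "x \<in> A \<Longrightarrow> f x \<le> infsum (f :: 'a \<Rightarrow> ennreal) A"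
  using sum_le_infsum_ennreal[of "{x}" A f] by simp

text \<open>Tonelli: a finite outer sum moves inside the inner one, so every partial sum is below
  the exchanged sum. The reverse inequality is the same statement with the index sets
  exchanged.\<close>

lemma infsum_ennreal_swap:
  "(\<Sum>\<^sub>\<infinity>x\<in>A. \<Sum>\<^sub>\<infinity>y\<in>B. f x y) = (\<Sum>\<^sub>\<infinity>y\<in>B. \<Sum>\<^sub>\<infinity>x\<in>A. (f x y :: ennreal))"
proof -
  have le: "(\<Sum>\<^sub>\<infinity>x\<in>A. \<Sum>\<^sub>\<infinity>y\<in>B. f x y) \<le> (\<Sum>\<^sub>\<infinity>y\<in>B. \<Sum>\<^sub>\<infinity>x\<in>A. (f x y :: ennreal))"
    for A :: "'x set" and B :: "'y set" and f
    unfolding infsum_ennreal_SUP[of "\<lambda>x. \<Sum>\<^sub>\<infinity>y\<in>B. f x y"]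
  proof (intro SUP_least)
    fix F assume "F \<in> {F. finite F \<and> F \<subseteq> A}"
    then show "(\<Sum>x\<in>F. \<Sum>\<^sub>\<infinity>y\<in>B. f x y) \<le> (\<Sum>\<^sub>\<infinity>y\<in>B. \<Sum>\<^sub>\<infinity>x\<in>A. f x y)"
      by (subst infsum_ennreal_sum[symmetric])
        (auto intro!: infsum_ennreal_mono sum_le_infsum_ennreal)
  qed
  show ?thesis
    by (intro antisym le)
qed

lemma sum_SUP_ennreal:
  assumes "finite F" "\<And>x. incseq (\<lambda>n. f n x)"
  shows "(\<Sum>x\<in>F. SUP n. f n x) = (SUP n. \<Sum>x\<in>F. (f n x :: ennreal))"
  using assms by (subst ennreal_SUP_sum) auto

text \<open>Monotone convergence: a sum is a supremum over finite subsets, two suprema commute, and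
  finite sums of increasing sequences commute with the supremum.\<close>

lemma infsum_ennreal_SUP_seq:
  assumes "\<And>x. incseq (\<lambda>n. f n x :: ennreal)"
  shows "(\<Sum>\<^sub>\<infinity>x\<in>A. SUP n. f n x) = (SUP n. \<Sum>\<^sub>\<infinity>x\<in>A. f n x)"
proof -
  have "(SUP F\<in>{F. finite F \<and> F \<subseteq> A}. \<Sum>x\<in>F. SUP n. f n x)
      = (SUP F\<in>{F. finite F \<and> F \<subseteq> A}. SUP n. \<Sum>x\<in>F. f n x)"
    by (rule SUP_cong) (auto simp: sum_SUP_ennreal assms)
  also have "\<dots> = (SUP n. SUP F\<in>{F. finite F \<and> F \<subseteq> A}. \<Sum>x\<in>F. f n x)"
    by (rule SUP_commute)
  finally show ?thesis
    by (simp add: infsum_ennreal_SUP)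
qed

lemma infsum_ennreal_delta:
  "(\<Sum>\<^sub>\<infinity>x\<in>A. if x = a then f x else 0) = (if a \<in> A then f a else (0 :: ennreal))"
proof (cases "a \<in> A")
  case True
  have "(\<Sum>\<^sub>\<infinity>x\<in>A. if x = a then f x else 0) = (\<Sum>\<^sub>\<infinity>x\<in>{a}. f x)"
    using True by (intro infsum_cong_neutral) auto
  then show ?thesis using True by simp
next
  case False
  then show ?thesis by (auto intro!: infsum_0)
qed

text \<open>Summation over the fibres of \<open>g\<close>; the indicator stands for the fibre, so
  that the exchange of sums applies.\<close>

lemma infsum_ennreal_regroup:
  "infsum f A = (\<Sum>\<^sub>\<infinity>y. \<Sum>\<^sub>\<infinity>x\<in>A. if y = g x then f x else (0 :: ennreal))"
  by (subst infsum_ennreal_swap) (simp add: infsum_ennreal_delta)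

lemma infsum_ennreal_eq_suminf: "infsum f UNIV = (\<Sum>n. f n :: ennreal)"
proof -
  have "(f has_sum infsum f UNIV) UNIV" by (rule has_sum_infsum[OF summable_on_ennreal'])
  then have "f sums infsum f UNIV" by (rule has_sum_imp_sums)
  then show ?thesis by (simp add: sums_unique)
qed

lemma infsum_length_Suc:
  "(\<Sum>\<^sub>\<infinity>xs\<in>{xs. length xs = Suc n}. f xs) =
    (\<Sum>\<^sub>\<infinity>x. \<Sum>\<^sub>\<infinity>xs\<in>{xs. length xs = n}. (f (x # xs) :: ennreal))"
proof -
  have "(\<Sum>\<^sub>\<infinity>xs\<in>{xs. length xs = Suc n}. if x = hd xs then f xs else 0) =
      (\<Sum>\<^sub>\<infinity>xs\<in>{xs. length xs = n}. f (x # xs))" for x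
  proof -
    have "(\<Sum>\<^sub>\<infinity>xs\<in>{xs. length xs = Suc n}. if x = hd xs then f xs else 0) =
        infsum f (Cons x ` {xs. length xs = n})"
      by (rule infsum_cong_neutral) (auto simp: length_Suc_conv image_iff)
    also have "\<dots> = (\<Sum>\<^sub>\<infinity>xs\<in>{xs. length xs = n}. f (x # xs))"
      by (subst infsum_reindex) (auto simp: o_def)
    finally show ?thesis .
  qed
  then show ?thesis
    by (subst infsum_ennreal_regroup[where g = hd]) simp
qed

lemma SUP_mult_SUP_ennreal:
  assumes "incseq f" "incseq g"
  shows "(SUP n. f n) * (SUP n. g n) = (SUP n. f n * g n :: ennreal)"
proof (rule antisym)
  \<comment> \<open>Every mixed product is below a diagonal one.\<close>
  have "f n * g m \<le> (SUP n. f n * g n)" for n m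
  proof -
    have "f n * g m \<le> f (max n m) * g (max n m)"
      using assms by (intro mult_mono) (auto simp: incseq_def)
    also have "\<dots> \<le> (SUP n. f n * g n)" by (rule SUP_upper) simp
    finally show ?thesis .
  qed
  then show "(SUP n. f n) * (SUP n. g n) \<le> (SUP n. f n * g n)"
    unfolding SUP_mult_right_ennreal SUP_mult_left_ennreal by (intro SUP_least)
  show "(SUP n. f n * g n) \<le> (SUP n. f n) * (SUP n. g n)"
    by (intro SUP_least mult_mono SUP_upper) auto
qed

lemma ennreal_divide_less_top: "a < top \<Longrightarrow> b \<noteq> 0 \<Longrightarrow> a / b < (top :: ennreal)"
  using ennreal_divide_eq_top_iff[of a b] top.not_eq_extremum[of "a / b"] by auto

section \<open>Uniqueness of coefficients\<close>

lemma powser_ennreal_coeffs_finite: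
  assumes "0 < \<epsilon>" and "(\<Sum>\<^sub>\<infinity>k. a k * ennreal \<epsilon> ^ k) < \<infinity>"
  shows "a k < \<infinity>"
proof -
  have "a k * ennreal \<epsilon> ^ k < \<infinity>"
    using elem_le_infsum_ennreal[of k UNIV "\<lambda>k. a k * ennreal \<epsilon> ^ k"] assms(2)
    by (auto intro: le_less_trans)
  moreover have "ennreal \<epsilon> ^ k \<noteq> 0" using assms(1) by simp
  ultimately show ?thesis
    by (auto simp: ennreal_mult_less_top less_top)
qed

text \<open>The difference of the two series vanishes on [0, \<epsilon>], so 0 is not an isolated
  zero and all its coefficients vanish. Finiteness at \<epsilon> makes the coefficients real;
  infinite coefficients in different positive degrees could define the same function.\<close>

lemma powser_ennreal_unique:
  fixes a b :: "nat \<Rightarrow> ennreal"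
  assumes "0 < \<epsilon>"
    and eq: "\<And>t. 0 \<le> t \<Longrightarrow> t \<le> \<epsilon> \<Longrightarrow>
      (\<Sum>\<^sub>\<infinity>k. a k * ennreal t ^ k) = (\<Sum>\<^sub>\<infinity>k. b k * ennreal t ^ k)"
    and fin: "(\<Sum>\<^sub>\<infinity>k. a k * ennreal \<epsilon> ^ k) < \<infinity>"
  shows "a k = b k"
proof -
  define a' b' where "a' k = enn2real (a k)" and "b' k = enn2real (b k)" for k
  have fin': "(\<Sum>\<^sub>\<infinity>k. b k * ennreal \<epsilon> ^ k) < \<infinity>"
    using fin eq[of \<epsilon>] assms(1) by simp
  have a: "a k = ennreal (a' k)" "0 \<le> a' k" and b: "b k = ennreal (b' k)" "0 \<le> b' k" for k
    using powser_ennreal_coeffs_finite[OF assms(1) fin] powser_ennreal_coeffs_finite[OF assms(1) fin']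
    by (auto simp: a'_def b'_def)
  \<comment> \<open>Domination by the value at \<epsilon> makes the real series at \<open>t\<close>
    converge, with the same sum.\<close>
  have sm: "(\<lambda>k. c k * t ^ k) sums enn2real (\<Sum>\<^sub>\<infinity>k. ennreal (c k) * ennreal t ^ k)"
    if "0 \<le> t" "t \<le> \<epsilon>" "\<And>k. 0 \<le> c k" "(\<Sum>\<^sub>\<infinity>k. ennreal (c k) * ennreal \<epsilon> ^ k) < \<infinity>" for c t
  proof -
    have "(\<Sum>\<^sub>\<infinity>k. ennreal (c k) * ennreal t ^ k) \<le> (\<Sum>\<^sub>\<infinity>k. ennreal (c k) * ennreal \<epsilon> ^ k)"
      using that by (intro infsum_ennreal_mono mult_left_mono power_mono) (auto simp: ennreal_leI)
    also have "\<dots> < top" using that by simp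
    finally have "(\<Sum>k. ennreal (c k * t ^ k)) \<noteq> top"
      using that by (simp add: infsum_ennreal_eq_suminf ennreal_power ennreal_mult)
    then have s: "summable (\<lambda>k. c k * t ^ k)"
      using that by (intro summable_suminf_not_top) auto
    have "(\<Sum>\<^sub>\<infinity>k. ennreal (c k) * ennreal t ^ k) = ennreal (\<Sum>k. c k * t ^ k)"
      using that s by (simp add: infsum_ennreal_eq_suminf ennreal_power ennreal_mult'[symmetric] suminf_ennreal2)
    then show ?thesis
      using s that by (simp add: suminf_nonneg summable_sums)
  qed
  have sd: "(\<lambda>k. (a' k - b' k) * t ^ k) sums 0"
    if t: "0 \<le> t" "t \<le> \<epsilon>" for t
  proof -
    have "(\<lambda>k. a' k * t ^ k - b' k * t ^ k) sums
        (enn2real (\<Sum>\<^sub>\<infinity>k. ennreal (a' k) * ennreal t ^ k) - enn2real (\<Sum>\<^sub>\<infinity>k. ennreal (b' k) * ennreal t ^ k))"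
      using sm[OF t, of a'] sm[OF t, of b'] fin fin' a b by (intro sums_diff) auto
    then show ?thesis
      using eq[OF t] by (simp add: a b left_diff_distrib)
  qed
  have "a' m = b' m" for m
  proof (rule ccontr)
    assume ne: "a' m \<noteq> b' m"
    define d where "d k = a' k - b' k" for k
    \<comment> \<open>The constant term is read off at 0, so the disagreement has positive degree,
      as the isolation of zeros requires.\<close>
    have "d 0 = 0"
      using sd[of 0] assms(1) by (simp add: d_def powser_sums_zero_iff)
    with ne have m: "d m \<noteq> 0" "0 < m"
      by (auto simp: d_def intro!: gr0I)
    define f where "f t = (\<Sum>k. d k * t ^ k)" for t
    \<comment> \<open>Vanishing is known on [0, \<epsilon>] only, but convergence at \<epsilon>
      gives convergence in the whole open ball.\<close>
    have summ: "summable (\<lambda>k. d k * t ^ k)" if "norm t < \<epsilon>" for t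
      using powser_inside[of d \<epsilon> t] sd[of \<epsilon>] assms(1) that by (auto simp: d_def sums_iff)
    have "(\<lambda>k. d k * (t - 0) ^ k) sums f t" if "norm (t - 0) < \<epsilon>" for t
      using summ[of t] that by (simp add: f_def summable_sums)
    moreover have "f 0 = 0"
      using sd[of 0] assms(1) by (simp add: f_def d_def sums_iff)
    ultimately obtain s where s: "0 < s" "\<And>z. z \<in> cball 0 s - {0} \<Longrightarrow> f z \<noteq> 0"
      using powser_0_nonzero[of \<epsilon> 0 d f m] assms(1) m by blast
    have "f (min s \<epsilon>) = 0"
      using sd[of "min s \<epsilon>"] s(1) assms(1) by (simp add: f_def d_def sums_iff)
    moreover have "min s \<epsilon> \<in> cball 0 s - {0}"
      using s(1) assms(1) by auto
    ultimately show False
      using s(2) by blast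
  qed
  then show ?thesis by (simp add: a b)
qed

lemma mpow_simps [simp]:
  "mpow u {#} = 1" "mpow u (add_mset a \<mu>) = u a * mpow u \<mu>" "mpow u (\<mu> + \<nu>) = mpow u \<mu> * mpow u \<nu>"
  "mpow u (replicate_mset k a) = u a ^ k"
  by (simp_all add: mpow_def)

lemma mpow_cong: "(\<And>a. a \<in># \<mu> \<Longrightarrow> u a = v a) \<Longrightarrow> mpow u \<mu> = mpow v \<mu>"
  unfolding mpow_def by (metis image_mset_cong)

lemma mpow_mono: "(\<And>a. u a \<le> v a) \<Longrightarrow> mpow u \<mu> \<le> mpow v \<mu>"
  by (induction \<mu>) (auto intro: mult_mono)

lemma mpow_eq_0_iff [simp]: "mpow u \<mu> = 0 \<longleftrightarrow> (\<exists>a\<in>#\<mu>. u a = 0)"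
  by (induction \<mu>) auto

lemma mpow_finite: "(\<And>a. a \<in># \<mu> \<Longrightarrow> u a < \<infinity>) \<Longrightarrow> mpow u \<mu> < \<infinity>"
  by (induction \<mu>) (auto simp: ennreal_mult_less_top)

text \<open>A multiset is uniquely a multiset avoiding \<open>v\<close> plus copies of
  \<open>v\<close>; the outer sum runs over their number.\<close>

lemma infsum_split_replicate:
  "infsum f UNIV = (\<Sum>\<^sub>\<infinity>k. \<Sum>\<^sub>\<infinity>\<nu>\<in>{\<nu>. v \<notin># \<nu>}. (f (\<nu> + replicate_mset k v) :: ennreal))"
proof -
  have "(\<Sum>\<^sub>\<infinity>\<mu>. if k = count \<mu> v then f \<mu> else 0) =
      (\<Sum>\<^sub>\<infinity>\<nu>\<in>{\<nu>. v \<notin># \<nu>}. f (\<nu> + replicate_mset k v))" for k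
  proof -
    have im: "{\<mu>. count \<mu> v = k} = (\<lambda>\<nu>. \<nu> + replicate_mset k v) ` {\<nu>. v \<notin># \<nu>}"
    proof (intro equalityI subsetI)
      fix \<mu> assume "\<mu> \<in> {\<mu>. count \<mu> v = k}"
      then have "\<mu> = filter_mset (\<lambda>a. a \<noteq> v) \<mu> + replicate_mset k v"
        by (auto intro!: multiset_eqI)
      then show "\<mu> \<in> (\<lambda>\<nu>. \<nu> + replicate_mset k v) ` {\<nu>. v \<notin># \<nu>}"
        by (intro image_eqI[where x = "filter_mset (\<lambda>a. a \<noteq> v) \<mu>"]) auto
    qed (auto simp: not_in_iff)
    have "(\<Sum>\<^sub>\<infinity>\<mu>. if k = count \<mu> v then f \<mu> else 0) = infsum f {\<mu>. count \<mu> v = k}"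
      by (rule infsum_cong_neutral) auto
    also have "\<dots> = (\<Sum>\<^sub>\<infinity>\<nu>\<in>{\<nu>. v \<notin># \<nu>}. f (\<nu> + replicate_mset k v))"
      unfolding im by (subst infsum_reindex) (auto simp: o_def inj_on_def)
    finally show ?thesis .
  qed
  then show ?thesis
    by (subst infsum_ennreal_regroup[where g = "\<lambda>\<mu>. count \<mu> v"]) simp
qed

text \<open>Isolates the variable \<open>v\<close>. As \<open>x v = 0\<close>, monomials containing
  \<open>v\<close> vanish at \<open>x\<close>; the coefficients of \<open>t ^ k\<close> can thus be
  sums over all multisets, that is, series of the original shape.\<close>

lemma mpow_series_split:
  assumes "x v = 0"
  shows "(\<Sum>\<^sub>\<infinity>\<mu>. A \<mu> * mpow (x(v := t)) \<mu>) =
    (\<Sum>\<^sub>\<infinity>k. (\<Sum>\<^sub>\<infinity>\<nu>. A (\<nu> + replicate_mset k v) * mpow x \<nu>) * t ^ k)"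
proof -
  have "(\<Sum>\<^sub>\<infinity>\<nu>\<in>{\<nu>. v \<notin># \<nu>}. A (\<nu> + replicate_mset k v) * mpow (x(v := t)) (\<nu> + replicate_mset k v)) =
      (\<Sum>\<^sub>\<infinity>\<nu>. A (\<nu> + replicate_mset k v) * mpow x \<nu>) * t ^ k" for k
  proof -
    have "(\<Sum>\<^sub>\<infinity>\<nu>\<in>{\<nu>. v \<notin># \<nu>}. A (\<nu> + replicate_mset k v) * mpow (x(v := t)) (\<nu> + replicate_mset k v)) =
        (\<Sum>\<^sub>\<infinity>\<nu>. A (\<nu> + replicate_mset k v) * mpow x \<nu> * t ^ k)"
    proof (rule infsum_cong_neutral)
      fix \<nu> assume "\<nu> \<in> {\<nu>. v \<notin># \<nu>} \<inter> UNIV"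
      then have "mpow (x(v := t)) \<nu> = mpow x \<nu>" by (intro mpow_cong) auto
      then show "A (\<nu> + replicate_mset k v) * mpow (x(v := t)) (\<nu> + replicate_mset k v) =
          A (\<nu> + replicate_mset k v) * mpow x \<nu> * t ^ k"
        by (simp add: mult.assoc)
    qed (use assms in auto)
    then show ?thesis by (simp add: infsum_ennreal_multc)
  qed
  then show ?thesis by (subst infsum_split_replicate[where v = v]) simp
qed

text \<open>Induction on the set of variables: with the others fixed, the one-variable result
  identifies the coefficients of the powers of \<open>v\<close>, which are series in the remaining
  variables. Finiteness accompanies equality in the hypothesis because both must be supplied for
  these coefficients.\<close>

lemma mpow_series_unique:
  assumes "finite V" "0 < \<epsilon>"
    and "\<And>x. (\<And>v. v \<in> V \<Longrightarrow> x v \<le> ennreal \<epsilon>) \<Longrightarrow> (\<And>v. v \<notin> V \<Longrightarrow> x v = 0) \<Longrightarrow>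
      (\<Sum>\<^sub>\<infinity>\<mu>. A \<mu> * mpow x \<mu>) = (\<Sum>\<^sub>\<infinity>\<mu>. B \<mu> * mpow x \<mu>) \<and> (\<Sum>\<^sub>\<infinity>\<mu>. A \<mu> * mpow x \<mu>) < \<infinity>"
    and "set_mset \<mu> \<subseteq> V"
  shows "A \<mu> = B \<mu>"
  using assms(1,3,4)
proof (induction V arbitrary: A B \<mu> rule: finite_induct)
  case empty
  have "(\<Sum>\<^sub>\<infinity>\<mu>. A \<mu> * mpow (\<lambda>_. 0) \<mu>) = A {#}" for A
  proof -
    have "(\<Sum>\<^sub>\<infinity>\<mu>. A \<mu> * mpow (\<lambda>_. 0) \<mu>) = (\<Sum>\<^sub>\<infinity>\<mu>\<in>{{#}}. A \<mu>)"
      by (rule infsum_cong_neutral) (auto simp: set_mset_eq_empty_iff)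
    then show ?thesis by simp
  qed
  then show ?case
    using empty(1)[of "\<lambda>_. 0"] empty(2) by simp
next
  case (insert v W)
  let ?sub = "\<lambda>A k \<nu>. A (\<nu> + replicate_mset k v)"
  have sub: "?sub A k \<nu> = ?sub B k \<nu>" if "set_mset \<nu> \<subseteq> W" for k \<nu>
  proof (rule insert.IH[OF _ that])
    fix x :: "pt \<Rightarrow> ennreal"
    assume x: "\<And>w. w \<in> W \<Longrightarrow> x w \<le> ennreal \<epsilon>" "\<And>w. w \<notin> W \<Longrightarrow> x w = 0"
    let ?a = "\<lambda>A k. \<Sum>\<^sub>\<infinity>\<nu>. ?sub A k \<nu> * mpow x \<nu>"
    have xv: "x v = 0" using x(2) insert(2) by auto
    have *: "(\<Sum>\<^sub>\<infinity>k. ?a A k * ennreal t ^ k) = (\<Sum>\<^sub>\<infinity>k. ?a B k * ennreal t ^ k) \<and>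
        (\<Sum>\<^sub>\<infinity>k. ?a A k * ennreal t ^ k) < \<infinity>" if "0 \<le> t" "t \<le> \<epsilon>" for t
      unfolding mpow_series_split[of x v, OF xv, symmetric]
      by (rule insert(4)) (use x that in \<open>auto simp: ennreal_leI\<close>)
    have fin: "(\<Sum>\<^sub>\<infinity>k. ?a A k * ennreal \<epsilon> ^ k) < \<infinity>"
      using *[of \<epsilon>] assms(2) by auto
    show "?a A k = ?a B k \<and> ?a A k < \<infinity>"
    proof
      show "?a A k = ?a B k"
        by (rule powser_ennreal_unique[OF assms(2) _ fin]) (use * in blast)
      show "?a A k < \<infinity>"
        by (rule powser_ennreal_coeffs_finite[OF assms(2) fin])
    qed
  qed
  have \<mu>: "\<mu> = filter_mset (\<lambda>a. a \<noteq> v) \<mu> + replicate_mset (count \<mu> v) v"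
    by (auto intro!: multiset_eqI)
  show ?case
    using sub[of "filter_mset (\<lambda>a. a \<noteq> v) \<mu>" "count \<mu> v"] insert(5) \<mu> by auto
qed

section \<open>Probabilistic coherence spaces of types\<close>

lemma fun_hat_mono: "(\<And>a. t a \<le> t' a) \<Longrightarrow> (\<And>a. u a \<le> u' a) \<Longrightarrow> fun_hat t u b \<le> fun_hat t' u' b"
  unfolding fun_hat_def by (intro infsum_ennreal_mono mult_mono mpow_mono) auto

lemma fun_hat_zero [simp]: "fun_hat (\<lambda>_. 0) u = (\<lambda>_. 0)"
  by (simp add: fun_hat_def)

lemma fun_hat_infsum:
  "fun_hat (\<lambda>a. \<Sum>\<^sub>\<infinity>i\<in>I. p i * t i a) u = (\<lambda>b. \<Sum>\<^sub>\<infinity>i\<in>I. p i * fun_hat (t i) u b)"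
  unfolding fun_hat_def
  by (simp add: infsum_ennreal_multc[symmetric] infsum_ennreal_cmult[symmetric] mult.assoc)
    (subst infsum_ennreal_swap, rule refl)

lemma fun_hat_add:
  "fun_hat (\<lambda>a. t a + s a) u = (\<lambda>b. fun_hat t u b + fun_hat s u b)"
  unfolding fun_hat_def by (simp add: distrib_right infsum_ennreal_add)

lemma fun_hat_cmult: "fun_hat (\<lambda>a. c * t a) u = (\<lambda>b. c * fun_hat t u b)"
  unfolding fun_hat_def by (simp add: mult.assoc infsum_ennreal_cmult)

lemma fun_hat_SUP:
  assumes "\<And>a. incseq (\<lambda>n. t n a)"
  shows "fun_hat (\<lambda>a. SUP n. t n a) u = (\<lambda>b. SUP n. fun_hat (t n) u b)"
proof
  fix b
  have "incseq (\<lambda>n. t n (PFun \<mu> b) * mpow u \<mu>)" for \<mu>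
    using assms by (auto simp: incseq_def intro: mult_right_mono)
  then show "fun_hat (\<lambda>a. SUP n. t n a) u b = (SUP n. fun_hat (t n) u b)"
    unfolding fun_hat_def by (simp add: SUP_mult_right_ennreal infsum_ennreal_SUP_seq)
qed

lemma mpow_SUP:
  assumes "\<And>a. incseq (\<lambda>n. u n a)"
  shows "mpow (\<lambda>a. SUP n. u n a) \<mu> = (SUP n. mpow (u n) \<mu>)"
proof (induction \<mu>)
  case (add a \<mu>)
  have "incseq (\<lambda>n. mpow (u n) \<mu>)"
    using assms by (auto simp: incseq_def intro: mpow_mono)
  then show ?case
    using add assms by (simp add: SUP_mult_SUP_ennreal)
qed auto

lemma fun_hat_continuous:
  assumes "\<And>a. incseq (\<lambda>n. u n a)"
  shows "fun_hat t (\<lambda>a. SUP n. u n a) b = (SUP n. fun_hat t (u n) b)"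
proof -
  have "incseq (\<lambda>n. t (PFun \<mu> b) * mpow (u n) \<mu>)" for \<mu>
    using assms by (auto simp: incseq_def intro!: mult_left_mono mpow_mono)
  then show ?thesis
    unfolding fun_hat_def by (simp add: mpow_SUP assms SUP_mult_left_ennreal infsum_ennreal_SUP_seq)
qed

lemma pcliques_family: "u \<in> pcliques \<sigma> \<Longrightarrow> u \<in> nonneg_families (web \<sigma>)"
  by (cases \<sigma>) auto

lemma pcliques_finite: "u \<in> pcliques \<sigma> \<Longrightarrow> u a < \<infinity>"
  using pcliques_family[of u \<sigma>] by (auto simp: nonneg_families_def)

lemma pcliques_outside: "u \<in> pcliques \<sigma> \<Longrightarrow> a \<notin> web \<sigma> \<Longrightarrow> u a = 0"
  using pcliques_family[of u \<sigma>] by (auto simp: nonneg_families_def)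

lemma nonneg_families_downward:
  assumes "v \<in> nonneg_families I" "\<And>a. u a \<le> v a"
  shows "u \<in> nonneg_families I"
proof -
  have "u a < \<infinity>" for a
    using assms(1) by (intro le_less_trans[OF assms(2)]) (auto simp: nonneg_families_def)
  moreover have "u a = 0" if "a \<notin> I" for a
    using assms(1) assms(2)[of a] that by (auto simp: nonneg_families_def)
  ultimately show ?thesis by (auto simp: nonneg_families_def)
qed

lemma pcliques_downward: "v \<in> pcliques \<sigma> \<Longrightarrow> (\<And>a. u a \<le> v a) \<Longrightarrow> u \<in> pcliques \<sigma>"
proof (induction \<sigma> arbitrary: u v)
  case TNat
  have "(\<Sum>\<^sub>\<infinity>n. u (PNat n)) \<le> (\<Sum>\<^sub>\<infinity>n. v (PNat n))"
    using TNat(2) by (intro infsum_ennreal_mono) auto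
  also have "\<dots> \<le> 1" using TNat(1) by simp
  finally show ?case
    using nonneg_families_downward[OF pcliques_family[OF TNat(1)] TNat(2)] by simp
next
  case (TFun \<sigma> \<tau>)
  have "u \<in> nonneg_families (web (TFun \<sigma> \<tau>))"
    using nonneg_families_downward[OF pcliques_family[OF TFun(3)] TFun(4)] .
  moreover have "fun_hat u w \<in> pcliques \<tau>" if "w \<in> pcliques \<sigma>" for w
  proof (rule TFun.IH(2))
    show "fun_hat v w \<in> pcliques \<tau>" using TFun(3) that by simp
    show "fun_hat u w b \<le> fun_hat v w b" for b
      by (rule fun_hat_mono[OF TFun(4) order_refl])
  qed
  ultimately show ?case by simp
qed

lemma zero_pcliques: "(\<lambda>_. 0) \<in> pcliques \<sigma>"
  by (induction \<sigma>) (auto simp: nonneg_families_def)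

lemma dirac_pcliques: "dirac n \<in> pcliques TNat"
  by (auto simp: dirac_def nonneg_families_def infsum_ennreal_delta)

text \<open>
  Boundedness at \<open>\<sigma> \<Rightarrow> \<tau>\<close> evaluates at a clique of \<open>\<sigma>\<close> that is positive on a whole multiset,
  which convexity provides, and closure under convex sums needs boundedness to stay finite: hence
  the simultaneous induction.
\<close>

lemma pcliques_convex_bounded_positive:
  "(\<forall>p v. (\<Sum>\<^sub>\<infinity>n::nat. p n) \<le> 1 \<longrightarrow> (\<forall>n. v n \<in> pcliques \<sigma>) \<longrightarrow>
      (\<lambda>a. \<Sum>\<^sub>\<infinity>n. p n * v n a) \<in> pcliques \<sigma>) \<and>
   (\<forall>a\<in>web \<sigma>. \<exists>C<\<infinity>. \<forall>u\<in>pcliques \<sigma>. u a \<le> C) \<and>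
   (\<forall>A. finite A \<longrightarrow> A \<subseteq> web \<sigma> \<longrightarrow> (\<exists>u\<in>pcliques \<sigma>. \<forall>a\<in>A. 0 < u a))"
proof -
  have fam: "(\<lambda>a. \<Sum>\<^sub>\<infinity>n. p n * v n a) \<in> nonneg_families (web \<sigma>)"
    if bd: "\<forall>a\<in>web \<sigma>. \<exists>C<\<infinity>. \<forall>u\<in>pcliques \<sigma>. u a \<le> C" and p: "(\<Sum>\<^sub>\<infinity>n::nat. p n) \<le> 1"
      and v: "\<And>n. v n \<in> pcliques \<sigma>"
    for p and v :: "nat \<Rightarrow> pvec" and \<sigma>
    unfolding nonneg_families_def
  proof (intro CollectI conjI allI impI)
    fix a
    show out: "(\<Sum>\<^sub>\<infinity>n. p n * v n a) = 0" if "a \<notin> web \<sigma>"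
      using pcliques_outside[OF v that] by simp
    show "(\<Sum>\<^sub>\<infinity>n. p n * v n a) < \<infinity>"
    proof (cases "a \<in> web \<sigma>")
      case True
      then obtain C where C: "C < \<infinity>" "\<And>n. v n a \<le> C" using bd v by blast
      have "(\<Sum>\<^sub>\<infinity>n. p n * v n a) \<le> (\<Sum>\<^sub>\<infinity>n. p n * C)"
        using C by (intro infsum_ennreal_mono mult_left_mono) auto
      also have "\<dots> \<le> 1 * C"
        unfolding infsum_ennreal_multc by (intro mult_right_mono p) auto
      finally show ?thesis using C(1) by (simp add: le_less_trans)
    qed (use out in simp)
  qed
  \<comment> \<open>Averaging with weights 1/2 joins a clique positive on \<open>A\<close> to one
    positive at a further point.\<close>
  have fin_pos: "\<exists>u\<in>pcliques \<sigma>. \<forall>a\<in>A. 0 < u a"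
    if conv: "\<And>p v. (\<Sum>\<^sub>\<infinity>n::nat. p n) \<le> 1 \<Longrightarrow> (\<And>n. v n \<in> pcliques \<sigma>) \<Longrightarrow>
        (\<lambda>a. \<Sum>\<^sub>\<infinity>n. p n * v n a) \<in> pcliques \<sigma>"
      and pos: "\<And>a. a \<in> web \<sigma> \<Longrightarrow> \<exists>u\<in>pcliques \<sigma>. 0 < u a"
      and A: "finite A" "A \<subseteq> web \<sigma>" for \<sigma> A
    using A
  proof (induction A rule: finite_induct)
    case empty
    then show ?case using zero_pcliques by auto
  next
    case (insert a A)
    obtain u where u: "u \<in> pcliques \<sigma>" "\<forall>a\<in>A. 0 < u a"
      using insert by auto
    obtain w where w: "w \<in> pcliques \<sigma>" "0 < w a"
      using pos[of a] insert by auto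
    define p :: "nat \<Rightarrow> ennreal" where "p n = (if n \<in> {0, 1} then 1 / 2 else 0)" for n
    define v where "v n = (if n = 0 then u else w)" for n :: nat
    have pe: "(\<Sum>\<^sub>\<infinity>n. p n * f n) = 1 / 2 * f 0 + 1 / 2 * f 1" for f
    proof -
      have "(\<Sum>\<^sub>\<infinity>n. p n * f n) = (\<Sum>\<^sub>\<infinity>n\<in>{0, 1}. p n * f n)"
        by (rule infsum_cong_neutral) (auto simp: p_def)
      then show ?thesis by (simp add: p_def)
    qed
    have "1 / 2 + 1 / 2 = (1 :: ennreal)"
      by (simp add: add_divide_distrib_ennreal[symmetric])
    then have "(\<Sum>\<^sub>\<infinity>n. p n) \<le> 1"
      using pe[of "\<lambda>_. 1"] by simp
    then have "(\<lambda>a. \<Sum>\<^sub>\<infinity>n. p n * v n a) \<in> pcliques \<sigma>"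
      by (rule conv) (simp add: v_def u w)
    moreover have "0 < (\<Sum>\<^sub>\<infinity>n. p n * v n b)" if "b \<in> insert a A" for b
    proof (cases "b = a")
      case True
      then show ?thesis using w(2) by (simp add: pe v_def zero_less_iff_neq_zero ennreal_divide_eq_0_iff)
    next
      case False
      then show ?thesis using u(2) that by (simp add: pe v_def zero_less_iff_neq_zero ennreal_divide_eq_0_iff)
    qed
    ultimately show ?case by (intro bexI[of _ "\<lambda>a. \<Sum>\<^sub>\<infinity>n. p n * v n a"]) auto
  qed
  show ?thesis
  proof (induction \<sigma>)
    case TNat
    have bd: "\<forall>a\<in>web TNat. \<exists>C<\<infinity>. \<forall>u\<in>pcliques TNat. u a \<le> C"
    proof (intro ballI exI[of _ 1] conjI)
      fix a u assume "a \<in> web TNat" "u \<in> pcliques TNat"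
      then obtain n where "a = PNat n" "(\<Sum>\<^sub>\<infinity>n. u (PNat n)) \<le> 1" by auto
      then show "u a \<le> 1"
        using elem_le_infsum_ennreal[of n UNIV "\<lambda>n. u (PNat n)"] by (auto intro: order_trans)
    qed auto
    have conv: "(\<lambda>a. \<Sum>\<^sub>\<infinity>n. p n * v n a) \<in> pcliques TNat"
      if p: "(\<Sum>\<^sub>\<infinity>n::nat. p n) \<le> 1" and v: "\<And>n. v n \<in> pcliques TNat" for p v
    proof -
      have "(\<Sum>\<^sub>\<infinity>m. \<Sum>\<^sub>\<infinity>n. p n * v n (PNat m)) = (\<Sum>\<^sub>\<infinity>n. p n * (\<Sum>\<^sub>\<infinity>m. v n (PNat m)))"
        by (subst infsum_ennreal_swap) (simp add: infsum_ennreal_cmult)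
      also have "\<dots> \<le> (\<Sum>\<^sub>\<infinity>n. p n * 1)"
        using v by (intro infsum_ennreal_mono mult_left_mono) auto
      finally show ?thesis
        using fam[OF bd p v] p by simp
    qed
    have pos: "\<exists>u\<in>pcliques TNat. 0 < u a" if a: "a \<in> web TNat" for a
    proof -
      obtain n where "a = PNat n" using a by auto
      then show ?thesis by (intro bexI[OF _ dirac_pcliques[of n]]) (simp add: dirac_def)
    qed
    show ?case
      by (intro conjI allI impI bd fin_pos[of TNat] conv pos) simp_all
  next
    case (TFun \<sigma> \<tau>)
    have bd: "\<forall>a\<in>web (TFun \<sigma> \<tau>). \<exists>C<\<infinity>. \<forall>u\<in>pcliques (TFun \<sigma> \<tau>). u a \<le> C"
    proof
      fix a assume "a \<in> web (TFun \<sigma> \<tau>)"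
      then obtain \<mu> b where a: "a = PFun \<mu> b" "set_mset \<mu> \<subseteq> web \<sigma>" "b \<in> web \<tau>" by auto
      then obtain u where u: "u \<in> pcliques \<sigma>" "\<forall>a\<in>#\<mu>. 0 < u a"
        using conjunct2[OF conjunct2[OF TFun.IH(1)]] finite_set_mset[of \<mu>] by metis
      obtain C where C: "C < \<infinity>" "\<forall>u\<in>pcliques \<tau>. u b \<le> C"
        using conjunct1[OF conjunct2[OF TFun.IH(2)]] a(3) by auto
      have nz: "mpow u \<mu> \<noteq> 0" using u(2) by auto
      \<comment> \<open>The entry times its monomial is one summand of \<open>fun_hat t u b\<close>,
        which is at most \<open>C\<close>; the monomial is positive.\<close>
      have "t a \<le> C / mpow u \<mu>" if "t \<in> pcliques (TFun \<sigma> \<tau>)" for t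
      proof -
        have "t a * mpow u \<mu> \<le> fun_hat t u b"
          unfolding fun_hat_def a(1) by (rule elem_le_infsum_ennreal) simp
        also have "\<dots> \<le> C" using C(2) that u(1) by auto
        finally have "t a * mpow u \<mu> / mpow u \<mu> \<le> C / mpow u \<mu>"
          by (rule divide_right_mono_ennreal)
        moreover have "mpow u \<mu> < \<infinity>"
          using pcliques_finite[OF u(1)] by (rule mpow_finite)
        ultimately show ?thesis
          using nz by (simp add: mult_divide_eq_ennreal)
      qed
      moreover have "C / mpow u \<mu> < \<infinity>"
        using ennreal_divide_less_top[of C "mpow u \<mu>"] C(1) nz by simp
      ultimately show "\<exists>C<\<infinity>. \<forall>u\<in>pcliques (TFun \<sigma> \<tau>). u a \<le> C"
        by (intro exI[of _ "C / mpow u \<mu>"]) simp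
    qed
    have conv: "(\<lambda>a. \<Sum>\<^sub>\<infinity>n. p n * v n a) \<in> pcliques (TFun \<sigma> \<tau>)"
      if p: "(\<Sum>\<^sub>\<infinity>n::nat. p n) \<le> 1" and v: "\<And>n. v n \<in> pcliques (TFun \<sigma> \<tau>)" for p v
    proof -
      have "fun_hat (\<lambda>a. \<Sum>\<^sub>\<infinity>n. p n * v n a) u \<in> pcliques \<tau>" if "u \<in> pcliques \<sigma>" for u
        unfolding fun_hat_infsum
        by (rule conjunct1[OF TFun.IH(2), rule_format, OF p]) (use v that in simp)
      then show ?thesis using fam[OF bd p v] by simp
    qed
    have pos: "\<exists>t\<in>pcliques (TFun \<sigma> \<tau>). 0 < t a" if aw: "a \<in> web (TFun \<sigma> \<tau>)" for a
    proof -
      obtain \<mu> b where a: "a = PFun \<mu> b" "set_mset \<mu> \<subseteq> web \<sigma>" "b \<in> web \<tau>" using aw by auto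
      have "\<exists>C<\<infinity>. \<forall>u\<in>pcliques \<sigma>. mpow u \<mu> \<le> C"
        using a(2)
      proof (induction \<mu>)
        case empty
        show ?case by (auto intro!: exI[of _ 1])
      next
        case (add x \<mu>)
        then obtain C where C: "C < \<infinity>" "\<forall>u\<in>pcliques \<sigma>. mpow u \<mu> \<le> C" by auto
        obtain D where D: "D < \<infinity>" "\<forall>u\<in>pcliques \<sigma>. u x \<le> D"
          using conjunct1[OF conjunct2[OF TFun.IH(1)]] add(2) by auto
        show ?case
          using C D by (intro exI[of _ "D * C"]) (simp add: ennreal_mult_less_top mult_mono)
      qed
      then obtain C0 where C0: "C0 < \<infinity>" "\<forall>u\<in>pcliques \<sigma>. mpow u \<mu> \<le> C0" by auto
      \<comment> \<open>The maximum with 1 allows division by the bound.\<close>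
      define C where "C = max 1 C0"
      have C: "C < \<infinity>" "C \<noteq> 0" "\<And>u. u \<in> pcliques \<sigma> \<Longrightarrow> mpow u \<mu> \<le> C"
        using C0 by (auto simp: C_def max_def)
      obtain w where w: "w \<in> pcliques \<tau>" "0 < w b"
        using conjunct2[OF conjunct2[OF TFun.IH(2)], rule_format, of "{b}"] a(3) by auto
      \<comment> \<open>Concentrated on the single multiset \<mu>: division by a bound of
        \<open>mpow u \<mu>\<close> over all cliques keeps every image below
        \<open>w\<close>.\<close>
      define t where "t c = (case c of PFun \<nu> d \<Rightarrow> if \<nu> = \<mu> then w d / C else 0 | _ \<Rightarrow> 0)" for c
      have hat: "fun_hat t u d = w d / C * mpow u \<mu>" for u d
      proof -
        have "fun_hat t u d = (\<Sum>\<^sub>\<infinity>\<nu>. if \<nu> = \<mu> then w d / C * mpow u \<nu> else 0)"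
          unfolding fun_hat_def t_def by (intro infsum_cong) auto
        then show ?thesis by (simp add: infsum_ennreal_delta)
      qed
      have "fun_hat t u \<in> pcliques \<tau>" if "u \<in> pcliques \<sigma>" for u
      proof (rule pcliques_downward[OF w(1)])
        fix d
        have "w d / C * mpow u \<mu> \<le> w d / C * C"
          by (intro mult_left_mono C(3) that) auto
        also have "\<dots> = w d"
          using C by (subst ennreal_divide_times) auto
        finally show "fun_hat t u d \<le> w d" by (simp add: hat)
      qed
      moreover have "t \<in> nonneg_families (web (TFun \<sigma> \<tau>))"
        using pcliques_finite[OF w(1)] pcliques_outside[OF w(1)] a C
        by (auto simp: nonneg_families_def t_def intro!: ennreal_divide_less_top split: pt.split)
      moreover have "0 < t a"
        using w C by (auto simp: t_def a ennreal_zero_less_divide)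
      ultimately show ?thesis by auto
    qed
    show ?case
      by (intro conjI allI impI bd fin_pos[of "TFun \<sigma> \<tau>"] conv pos) simp_all
  qed
qed

lemma pcliques_convex:
  "(\<Sum>\<^sub>\<infinity>n::nat. p n) \<le> 1 \<Longrightarrow> (\<And>n. v n \<in> pcliques \<sigma>) \<Longrightarrow> (\<lambda>a. \<Sum>\<^sub>\<infinity>n. p n * v n a) \<in> pcliques \<sigma>"
  by (rule conjunct1[OF pcliques_convex_bounded_positive, rule_format])

lemma pcliques_bounded:
  "\<exists>C<\<infinity>. \<forall>u\<in>pcliques \<sigma>. u a \<le> C"
proof (cases "a \<in> web \<sigma>")
  case False
  then show ?thesis by (intro exI[of _ 0]) (simp add: pcliques_outside[of _ \<sigma> a])
next
  case True
  then show ?thesis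
    by (rule bspec[OF conjunct1[OF conjunct2[OF pcliques_convex_bounded_positive[of \<sigma>]]]])
qed

lemma pcliques_positive: "finite A \<Longrightarrow> A \<subseteq> web \<sigma> \<Longrightarrow> \<exists>u\<in>pcliques \<sigma>. \<forall>a\<in>A. 0 < u a"
  by (rule conjunct2[OF conjunct2[OF pcliques_convex_bounded_positive], rule_format])

text \<open>At a function type, application commutes with the supremum, which reduces the claim to
  the result type. The supremum stays finite because all cliques are uniformly bounded at each
  point.\<close>

lemma pcliques_SUP:
  assumes "\<And>a. incseq (\<lambda>n. u n a)" "\<And>n. u n \<in> pcliques \<sigma>"
  shows "(\<lambda>a. SUP n. u n a) \<in> pcliques \<sigma>"
proof -
  have fam: "(\<lambda>a. SUP n. u n a) \<in> nonneg_families (web \<sigma>)"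
    if u: "\<And>n. u n \<in> pcliques \<sigma>" for \<sigma> and u :: "nat \<Rightarrow> pvec"
    unfolding nonneg_families_def
  proof (intro CollectI conjI allI impI)
    fix a
    obtain C where C: "C < \<infinity>" "\<And>u. u \<in> pcliques \<sigma> \<Longrightarrow> u a \<le> C"
      using pcliques_bounded[of \<sigma> a] by auto
    have "(SUP n. u n a) \<le> C" by (intro SUP_least C(2) u)
    then show "(SUP n. u n a) < \<infinity>" using C(1) by (rule le_less_trans)
    show "(SUP n. u n a) = 0" if "a \<notin> web \<sigma>"
      using pcliques_outside[OF u that] by simp
  qed
  show ?thesis
    using assms
  proof (induction \<sigma> arbitrary: u)
    case TNat
    have "(\<Sum>\<^sub>\<infinity>m. SUP n. u n (PNat m)) = (SUP n. \<Sum>\<^sub>\<infinity>m. u n (PNat m))"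
      by (rule infsum_ennreal_SUP_seq) (rule TNat)
    also have "\<dots> \<le> 1" using TNat(2) by (auto intro: SUP_least)
    finally show ?case using fam[OF TNat(2)] by simp
  next
    case (TFun \<sigma> \<tau>)
    have "fun_hat (\<lambda>a. SUP n. u n a) v \<in> pcliques \<tau>" if "v \<in> pcliques \<sigma>" for v
      unfolding fun_hat_SUP[OF TFun(3)]
    proof (rule TFun.IH(2))
      show "incseq (\<lambda>n. fun_hat (u n) v b)" for b
        using TFun(3) by (auto simp: incseq_def intro: fun_hat_mono)
      show "fun_hat (u n) v \<in> pcliques \<tau>" for n
        using TFun(4)[of n] that by auto
    qed
    then show ?case using fam[OF TFun(4)] by simp
  qed
qed

text \<open>Some clique is positive on all of \<open>A\<close>; its least value there is a possible
  side, by downward closure.\<close>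

lemma pcliques_cube:
  assumes "finite A" "A \<subseteq> web \<sigma>"
  obtains \<epsilon> where "0 < \<epsilon>"
    "\<And>x. (\<And>a. a \<in> A \<Longrightarrow> x a \<le> ennreal \<epsilon>) \<Longrightarrow> (\<And>a. a \<notin> A \<Longrightarrow> x a = 0) \<Longrightarrow> x \<in> pcliques \<sigma>"
proof -
  obtain u where u: "u \<in> pcliques \<sigma>" "\<forall>a\<in>A. 0 < u a"
    using pcliques_positive[OF assms] by blast
  \<comment> \<open>The 1 keeps the set nonempty when \<open>A\<close> is empty.\<close>
  define \<epsilon> where "\<epsilon> = Min (insert 1 ((\<lambda>a. enn2real (u a)) ` A))"
  have "0 < \<epsilon>"
    unfolding \<epsilon>_def using assms(1) u pcliques_finite[OF u(1)]
    by (subst Min_gr_iff) (auto simp: enn2real_positive_iff)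
  have le: "ennreal \<epsilon> \<le> u a" if "a \<in> A" for a
  proof -
    have "\<epsilon> \<le> enn2real (u a)" unfolding \<epsilon>_def using assms(1) that by (intro Min_le) auto
    then show ?thesis
      using pcliques_finite[OF u(1), of a] by (metis ennreal_enn2real ennreal_leI infinity_ennreal_def)
  qed
  show thesis
  proof (rule that[OF \<open>0 < \<epsilon>\<close>])
    fix x :: pvec
    assume x: "\<And>a. a \<in> A \<Longrightarrow> x a \<le> ennreal \<epsilon>" "\<And>a. a \<notin> A \<Longrightarrow> x a = 0"
    show "x \<in> pcliques \<sigma>"
    proof (rule pcliques_downward[OF u(1)])
      show "x a \<le> u a" for a
        using order_trans[OF x(1)[of a] le[of a]] x(2)[of a] by (cases "a \<in> A") simp_all
    qed
  qed
qed

lemma pcliques_series_unique: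
  assumes "\<And>u. u \<in> pcliques \<sigma> \<Longrightarrow> (\<Sum>\<^sub>\<infinity>\<mu>. A \<mu> * mpow u \<mu>) = (\<Sum>\<^sub>\<infinity>\<mu>. B \<mu> * mpow u \<mu>)"
    and "\<And>u. u \<in> pcliques \<sigma> \<Longrightarrow> (\<Sum>\<^sub>\<infinity>\<mu>. A \<mu> * mpow u \<mu>) < \<infinity>"
    and "set_mset \<mu> \<subseteq> web \<sigma>"
  shows "A \<mu> = B \<mu>"
proof -
  obtain \<epsilon> where \<epsilon>: "0 < \<epsilon>" "\<And>x. (\<And>a. a \<in># \<mu> \<Longrightarrow> x a \<le> ennreal \<epsilon>) \<Longrightarrow> (\<And>a. a \<notin># \<mu> \<Longrightarrow> x a = 0) \<Longrightarrow> x \<in> pcliques \<sigma>"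
    by (rule pcliques_cube[OF finite_set_mset assms(3)]) blast
  show ?thesis
    by (rule mpow_series_unique[OF finite_set_mset \<epsilon>(1) _ subset_refl]) (intro conjI assms(1,2) \<epsilon>(2))
qed

lemma series_coeff_finite:
  assumes "\<And>u. u \<in> pcliques \<sigma> \<Longrightarrow> (\<Sum>\<^sub>\<infinity>\<mu>. A \<mu> * mpow u \<mu>) < \<infinity>"
    and "set_mset \<mu> \<subseteq> web \<sigma>"
  shows "A \<mu> < \<infinity>"
proof -
  obtain u where u: "u \<in> pcliques \<sigma>" "\<forall>a\<in>#\<mu>. 0 < u a"
    using pcliques_positive[OF finite_set_mset assms(2)] by blast
  have "A \<mu> * mpow u \<mu> < \<infinity>"
    by (rule le_less_trans[OF elem_le_infsum_ennreal[where f = "\<lambda>\<mu>. A \<mu> * mpow u \<mu>"] assms(1)[OF u(1)]]) simp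
  moreover have "mpow u \<mu> \<noteq> 0" using u(2) by auto
  ultimately show ?thesis by (auto simp: ennreal_mult_less_top)
qed

section \<open>Power series in several variables\<close>

definition pmonom :: "pvec list \<Rightarrow> pt multiset list \<Rightarrow> ennreal" where
  "pmonom us \<mu>s = prod_list (map2 mpow us \<mu>s)"

definition series :: "(pt multiset list \<Rightarrow> ennreal) \<Rightarrow> pvec list \<Rightarrow> ennreal" where
  "series c us = (\<Sum>\<^sub>\<infinity>\<mu>s\<in>{\<mu>s. length \<mu>s = length us}. c \<mu>s * pmonom us \<mu>s)"

abbreviation multiindex :: "ty list \<Rightarrow> pt multiset list \<Rightarrow> bool" where
  "multiindex \<Gamma> \<mu>s \<equiv> list_all2 (\<lambda>\<mu> \<tau>. set_mset \<mu> \<subseteq> web \<tau>) \<mu>s \<Gamma>"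

lemma hat_series: "hat F us b = series (\<lambda>\<mu>s. F (\<mu>s, b)) us"
  by (simp add: hat_def series_def pmonom_def)

lemma pmonom_Cons [simp]: "pmonom (u # us) (\<mu> # \<mu>s) = mpow u \<mu> * pmonom us \<mu>s"
  and pmonom_Nil [simp]: "pmonom [] [] = 1"
  by (simp_all add: pmonom_def)

lemma series_Nil [simp]: "series c [] = c []"
  by (simp add: series_def)

text \<open>Currying: a series in the first variable whose coefficients are series in the others. It
  drives the inductions on contexts and explains why an abstraction denotes a power series.\<close>

lemma series_Cons: "series c (u # us) = (\<Sum>\<^sub>\<infinity>\<mu>. series (\<lambda>\<mu>s. c (\<mu> # \<mu>s)) us * mpow u \<mu>)"
proof -
  have "series c (u # us) =
      (\<Sum>\<^sub>\<infinity>\<mu>. \<Sum>\<^sub>\<infinity>\<mu>s\<in>{\<mu>s. length \<mu>s = length us}. c (\<mu> # \<mu>s) * pmonom us \<mu>s * mpow u \<mu>)"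
    unfolding series_def by (simp add: infsum_length_Suc mult_ac)
  then show ?thesis
    by (simp add: series_def infsum_ennreal_multc)
qed

lemma envs_Nil [simp]: "envs [] = {[]}"
  by (auto simp: envs_def)

lemma envs_Cons [simp]: "u # us \<in> envs (\<sigma> # \<Gamma>) \<longleftrightarrow> u \<in> pcliques \<sigma> \<and> us \<in> envs \<Gamma>"
  by (auto simp: envs_def)

lemma envs_ConsE:
  assumes "us \<in> envs (\<sigma> # \<Gamma>)"
  obtains u us' where "us = u # us'" "u \<in> pcliques \<sigma>" "us' \<in> envs \<Gamma>"
  using assms by (auto simp: envs_def list_all2_Cons2)

lemma envs_length: "us \<in> envs \<Gamma> \<Longrightarrow> length us = length \<Gamma>"
  by (auto simp: envs_def list_all2_lengthD)

lemma envs_nth: "us \<in> envs \<Gamma> \<Longrightarrow> i < length \<Gamma> \<Longrightarrow> us ! i \<in> pcliques (\<Gamma> ! i)"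
  by (auto simp: envs_def list_all2_conv_all_nth)

text \<open>With the other arguments fixed, uniqueness in the first variable compares the
  coefficient series, to which the induction hypothesis applies. Finiteness is part of the
  conclusion, so the instance \<open>c = d\<close> serves as a finiteness criterion.\<close>

lemma series_list_unique:
  assumes "\<And>us. us \<in> envs \<Gamma> \<Longrightarrow> series c us = series d us"
    and "\<And>us. us \<in> envs \<Gamma> \<Longrightarrow> series c us < \<infinity>"
    and "multiindex \<Gamma> \<mu>s"
  shows "c \<mu>s = d \<mu>s \<and> c \<mu>s < \<infinity>"
  using assms
proof (induction \<Gamma> arbitrary: c d \<mu>s)
  case Nil
  then show ?case using Nil(1)[of "[]"] Nil(2)[of "[]"] by simp
next
  case (Cons \<sigma> \<Gamma>)
  obtain \<mu> \<nu>s where \<mu>: "\<mu>s = \<mu> # \<nu>s" "set_mset \<mu> \<subseteq> web \<sigma>" "multiindex \<Gamma> \<nu>s"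
    using Cons.prems(3) by (auto simp: list_all2_Cons2)
  have "(\<lambda>\<mu>s. c (\<mu> # \<mu>s)) \<nu>s = (\<lambda>\<mu>s. d (\<mu> # \<mu>s)) \<nu>s \<and> (\<lambda>\<mu>s. c (\<mu> # \<mu>s)) \<nu>s < \<infinity>"
  proof (rule Cons.IH[OF _ _ \<mu>(3)])
    fix us assume us: "us \<in> envs \<Gamma>"
    have fin: "(\<Sum>\<^sub>\<infinity>\<mu>. series (\<lambda>\<mu>s. c (\<mu> # \<mu>s)) us * mpow u \<mu>) < \<infinity>" if "u \<in> pcliques \<sigma>" for u
      using Cons.prems(2)[of "u # us"] us that by (simp add: series_Cons)
    show "series (\<lambda>\<mu>s. c (\<mu> # \<mu>s)) us = series (\<lambda>\<mu>s. d (\<mu> # \<mu>s)) us"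
    proof (rule pcliques_series_unique[where A = "\<lambda>\<mu>. series (\<lambda>\<mu>s. c (\<mu> # \<mu>s)) us", OF _ fin \<mu>(2)])
      fix u assume "u \<in> pcliques \<sigma>"
      then show "(\<Sum>\<^sub>\<infinity>\<mu>. series (\<lambda>\<mu>s. c (\<mu> # \<mu>s)) us * mpow u \<mu>) =
          (\<Sum>\<^sub>\<infinity>\<mu>. series (\<lambda>\<mu>s. d (\<mu> # \<mu>s)) us * mpow u \<mu>)"
        using Cons.prems(1)[of "u # us"] us by (simp add: series_Cons)
    qed
    show "series (\<lambda>\<mu>s. c (\<mu> # \<mu>s)) us < \<infinity>"
      by (rule series_coeff_finite[where A = "\<lambda>\<mu>. series (\<lambda>\<mu>s. c (\<mu> # \<mu>s)) us", OF fin \<mu>(2)])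
  qed
  then show ?case unfolding \<mu>(1) .
qed

lemma pmonom_outside:
  assumes "us \<in> envs \<Gamma>" "length \<mu>s = length us" "\<not> multiindex \<Gamma> \<mu>s"
  shows "pmonom us \<mu>s = 0"
  using assms
proof (induction \<Gamma> arbitrary: us \<mu>s)
  case (Cons \<sigma> \<Gamma>)
  obtain u us' where us: "us = u # us'" "u \<in> pcliques \<sigma>" "us' \<in> envs \<Gamma>"
    using Cons.prems(1) by (rule envs_ConsE)
  obtain \<mu> \<nu>s where \<mu>: "\<mu>s = \<mu> # \<nu>s" "length \<nu>s = length us'"
    using Cons.prems(2) us(1) by (cases \<mu>s) auto
  show ?case
  proof (cases "set_mset \<mu> \<subseteq> web \<sigma>")
    case True
    then have "pmonom us' \<nu>s = 0" using Cons.IH[OF us(3) \<mu>(2)] Cons.prems(3) \<mu>(1) by auto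
    then show ?thesis by (simp add: us(1) \<mu>(1))
  next
    case False
    then obtain a where "a \<in># \<mu>" "u a = 0" using pcliques_outside[OF us(2)] by blast
    then have "mpow u \<mu> = 0" by auto
    then show ?thesis by (simp add: us(1) \<mu>(1))
  qed
qed simp

text \<open>Coefficients outside the webs can be cut off: a clique vanishes outside its web, and so
  do the monomials concerned.\<close>

lemma series_restrict:
  assumes "us \<in> envs \<Gamma>"
  shows "series (\<lambda>\<mu>s. if multiindex \<Gamma> \<mu>s then c \<mu>s else 0) us = series c us"
  unfolding series_def
  by (rule infsum_cong) (use pmonom_outside[OF assms] in auto)

section \<open>Analytic functions\<close>

text \<open>Coefficients may be infinite or lie outside the webs, and only values on environments of
  cliques count. This laxity makes the closure properties unconditional; the proper family is
  extracted at the end, for functions with values in cliques.\<close>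

definition analytic :: "ty list \<Rightarrow> (pvec list \<Rightarrow> ennreal) \<Rightarrow> bool" where
  "analytic \<Gamma> g \<longleftrightarrow> (\<exists>c. \<forall>us\<in>envs \<Gamma>. g us = series c us)"

lemma analytic_cong: "(\<And>us. us \<in> envs \<Gamma> \<Longrightarrow> g us = h us) \<Longrightarrow> analytic \<Gamma> h \<Longrightarrow> analytic \<Gamma> g"
  by (auto simp: analytic_def)

lemma analytic_series: "analytic \<Gamma> (series c)"
  by (auto simp: analytic_def)

lemma analytic_hat: "analytic \<Gamma> (\<lambda>us. hat F us b)"
  unfolding hat_series by (rule analytic_series)

text \<open>Nonnegative coefficients add up without any convergence condition, since sums in
  [0,\<infinity>] commute.\<close>

lemma analytic_infsum:
  assumes "\<And>j. j \<in> J \<Longrightarrow> analytic \<Gamma> (g j)"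
  shows "analytic \<Gamma> (\<lambda>us. \<Sum>\<^sub>\<infinity>j\<in>J. g j us)"
proof -
  have "\<exists>c. \<forall>j\<in>J. \<forall>us\<in>envs \<Gamma>. g j us = series (c j) us"
    using assms unfolding analytic_def by (intro bchoice) blast
  then obtain c where c: "\<forall>j\<in>J. \<forall>us\<in>envs \<Gamma>. g j us = series (c j) us" ..
  have "(\<Sum>\<^sub>\<infinity>j\<in>J. g j us) = series (\<lambda>\<mu>s. \<Sum>\<^sub>\<infinity>j\<in>J. c j \<mu>s) us" if "us \<in> envs \<Gamma>" for us
  proof -
    have "(\<Sum>\<^sub>\<infinity>j\<in>J. g j us) = (\<Sum>\<^sub>\<infinity>j\<in>J. series (c j) us)"
      using c that by (intro infsum_cong) simp
    also have "\<dots> = series (\<lambda>\<mu>s. \<Sum>\<^sub>\<infinity>j\<in>J. c j \<mu>s) us"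
      unfolding series_def infsum_ennreal_multc[symmetric] by (rule infsum_ennreal_swap)
    finally show ?thesis .
  qed
  then show ?thesis unfolding analytic_def by blast
qed

lemma analytic_cmult:
  assumes "analytic \<Gamma> g" shows "analytic \<Gamma> (\<lambda>us. k * g us)"
proof -
  obtain c where "\<forall>us\<in>envs \<Gamma>. g us = series c us" using assms by (auto simp: analytic_def)
  then have "\<forall>us\<in>envs \<Gamma>. k * g us = series (\<lambda>\<mu>s. k * c \<mu>s) us"
    by (simp add: series_def mult.assoc infsum_ennreal_cmult)
  then show ?thesis unfolding analytic_def by blast
qed

lemma analytic_add:
  assumes "analytic \<Gamma> g" "analytic \<Gamma> h" shows "analytic \<Gamma> (\<lambda>us. g us + h us)"
proof -
  obtain c d where "\<forall>us\<in>envs \<Gamma>. g us = series c us" "\<forall>us\<in>envs \<Gamma>. h us = series d us"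
    using assms by (auto simp: analytic_def)
  then have "\<forall>us\<in>envs \<Gamma>. g us + h us = series (\<lambda>\<mu>s. c \<mu>s + d \<mu>s) us"
    by (simp add: series_def distrib_right infsum_ennreal_add)
  then show ?thesis unfolding analytic_def by blast
qed

lemma analytic_pmonom:
  assumes "length \<alpha>s = length \<Gamma>" shows "analytic \<Gamma> (\<lambda>us. pmonom us \<alpha>s)"
proof -
  have "pmonom us \<alpha>s = series (\<lambda>\<mu>s. if \<mu>s = \<alpha>s then 1 else 0) us" if "us \<in> envs \<Gamma>" for us
  proof -
    have "series (\<lambda>\<mu>s. if \<mu>s = \<alpha>s then 1 else 0) us =
        (\<Sum>\<^sub>\<infinity>\<mu>s\<in>{\<mu>s. length \<mu>s = length us}. if \<mu>s = \<alpha>s then pmonom us \<mu>s else 0)"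
      unfolding series_def by (rule infsum_cong) simp
    then show ?thesis
      using assms envs_length[OF that] by (simp add: infsum_ennreal_delta)
  qed
  then show ?thesis unfolding analytic_def by blast
qed

lemma pmonom_replicate_empty: "pmonom us (replicate (length us) {#}) = 1"
  by (induction us) auto

lemma pmonom_coordinate:
  "i < length us \<Longrightarrow> pmonom us ((replicate (length us) {#})[i := {#a#}]) = (us ! i) a"
  by (induction us arbitrary: i) (auto simp: pmonom_replicate_empty split: nat.split)

lemma analytic_const: "analytic \<Gamma> (\<lambda>us. k)"
proof (rule analytic_cong)
  show "analytic \<Gamma> (\<lambda>us. k * pmonom us (replicate (length \<Gamma>) {#}))"
    by (intro analytic_cmult analytic_pmonom) simp
  show "k = k * pmonom us (replicate (length \<Gamma>) {#})" if "us \<in> envs \<Gamma>" for us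
    using pmonom_replicate_empty[of us] envs_length[OF that] by simp
qed

lemma analytic_nth:
  assumes "i < length \<Gamma>" shows "analytic \<Gamma> (\<lambda>us. (us ! i) a)"
proof (rule analytic_cong)
  show "analytic \<Gamma> (\<lambda>us. pmonom us ((replicate (length \<Gamma>) {#})[i := {#a#}]))"
    by (intro analytic_pmonom) simp
  show "(us ! i) a = pmonom us ((replicate (length \<Gamma>) {#})[i := {#a#}])" if "us \<in> envs \<Gamma>" for us
    using pmonom_coordinate[of i us] envs_length[OF that] assms by simp
qed

lemma pmonom_mult:
  "length \<alpha>s = length us \<Longrightarrow> length \<beta>s = length us \<Longrightarrow>
    pmonom us \<alpha>s * pmonom us \<beta>s = pmonom us (map2 (+) \<alpha>s \<beta>s)"
proof (induction us arbitrary: \<alpha>s \<beta>s)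
  case (Cons u us)
  obtain \<alpha> \<alpha>s' \<beta> \<beta>s' where "\<alpha>s = \<alpha> # \<alpha>s'" "\<beta>s = \<beta> # \<beta>s'"
    using Cons.prems by (metis length_Suc_conv length_Cons)
  with Cons.prems Cons.IH[of \<alpha>s' \<beta>s', symmetric] show ?case
    by (simp add: mult_ac)
qed simp

text \<open>The product is expanded into a double sum of monomials and left so; closure under
  infinite sums spares the convolution of coefficients.\<close>

lemma analytic_mult:
  assumes "analytic \<Gamma> g" "analytic \<Gamma> h" shows "analytic \<Gamma> (\<lambda>us. g us * h us)"
proof -
  obtain c d where cd: "\<forall>us\<in>envs \<Gamma>. g us = series c us" "\<forall>us\<in>envs \<Gamma>. h us = series d us"
    using assms by (auto simp: analytic_def)
  let ?L = "{\<mu>s :: pt multiset list. length \<mu>s = length \<Gamma>}"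
  show ?thesis
  proof (rule analytic_cong)
    fix us assume us: "us \<in> envs \<Gamma>"
    note l = envs_length[OF us]
    have "g us * h us = (\<Sum>\<^sub>\<infinity>\<alpha>s\<in>?L. \<Sum>\<^sub>\<infinity>\<beta>s\<in>?L. (c \<alpha>s * pmonom us \<alpha>s) * (d \<beta>s * pmonom us \<beta>s))"
      using cd us by (simp add: series_def l infsum_ennreal_cmult infsum_ennreal_multc)
    also have "\<dots> = (\<Sum>\<^sub>\<infinity>\<alpha>s\<in>?L. \<Sum>\<^sub>\<infinity>\<beta>s\<in>?L. c \<alpha>s * d \<beta>s * pmonom us (map2 (+) \<alpha>s \<beta>s))"
      by (intro infsum_cong) (simp add: pmonom_mult[symmetric] l mult_ac)
    finally show "g us * h us = (\<Sum>\<^sub>\<infinity>\<alpha>s\<in>?L. \<Sum>\<^sub>\<infinity>\<beta>s\<in>?L. c \<alpha>s * d \<beta>s * pmonom us (map2 (+) \<alpha>s \<beta>s))" .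
  qed (intro analytic_infsum analytic_cmult analytic_pmonom, simp)
qed

lemma analytic_mpow:
  assumes "\<And>a. analytic \<Gamma> (\<lambda>us. u us a)"
  shows "analytic \<Gamma> (\<lambda>us. mpow (u us) m)"
  by (induction m) (simp_all add: analytic_const analytic_mult assms)

lemma analytic_fun_hat:
  assumes "\<And>a. analytic \<Gamma> (\<lambda>us. t us a)" "\<And>a. analytic \<Gamma> (\<lambda>us. u us a)"
  shows "analytic \<Gamma> (\<lambda>us. fun_hat (t us) (u us) b)"
  unfolding fun_hat_def by (intro analytic_infsum analytic_mult analytic_mpow assms)

text \<open>Freezes the first argument: the second branch of a conditional is evaluated at
  \<open>dirac n\<close>, for each \<open>n\<close> separately.\<close>

lemma analytic_hat_Cons: "analytic \<Gamma> (\<lambda>us. hat F (w # us) b)"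
  unfolding hat_series series_Cons
  by (intro analytic_infsum analytic_mult analytic_series analytic_const)

text \<open>
  The coefficient-wise order: an increasing sequence for this order has an analytic supremum,
  the sum of its successive differences.
\<close>

definition analytic_le :: "ty list \<Rightarrow> (pvec list \<Rightarrow> ennreal) \<Rightarrow> (pvec list \<Rightarrow> ennreal) \<Rightarrow> bool" where
  "analytic_le \<Gamma> g h \<longleftrightarrow> (\<exists>d. analytic \<Gamma> d \<and> (\<forall>us\<in>envs \<Gamma>. h us = g us + d us))"

lemma analytic_le_mpow:
  assumes "\<And>a. analytic \<Gamma> (\<lambda>us. u us a)" "\<And>a. analytic_le \<Gamma> (\<lambda>us. u us a) (\<lambda>us. v us a)"
  shows "analytic_le \<Gamma> (\<lambda>us. mpow (u us) m) (\<lambda>us. mpow (v us) m)"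
proof (induction m)
  case empty
  then show ?case
    unfolding analytic_le_def by (intro exI[of _ "\<lambda>_. 0"]) (simp add: analytic_const)
next
  case (add a m)
  obtain d where d: "analytic \<Gamma> d" "\<forall>us\<in>envs \<Gamma>. mpow (v us) m = mpow (u us) m + d us"
    using add by (auto simp: analytic_le_def)
  obtain e where e: "analytic \<Gamma> e" "\<forall>us\<in>envs \<Gamma>. v us a = u us a + e us"
    using assms(2)[of a] by (auto simp: analytic_le_def)
  show ?case
    unfolding analytic_le_def
  proof (intro exI conjI)
    \<comment> \<open>The three new terms of the product of \<open>u us a + e us\<close> and
      \<open>mpow (u us) m + d us\<close>, obtained without subtraction.\<close>
    show "analytic \<Gamma> (\<lambda>us. u us a * d us + (e us * mpow (u us) m + e us * d us))"
      by (intro analytic_add analytic_mult analytic_mpow assms d(1) e(1))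
    show "\<forall>us\<in>envs \<Gamma>. mpow (v us) (add_mset a m) = mpow (u us) (add_mset a m) +
        (u us a * d us + (e us * mpow (u us) m + e us * d us))"
      using d(2) e(2) by (simp add: distrib_left distrib_right add_ac)
  qed
qed

lemma analytic_le_fun_hat:
  assumes t: "\<And>a. analytic \<Gamma> (\<lambda>us. t us a)"
    and u: "\<And>a. analytic \<Gamma> (\<lambda>us. u us a)" "\<And>a. analytic_le \<Gamma> (\<lambda>us. u us a) (\<lambda>us. v us a)"
  shows "analytic_le \<Gamma> (\<lambda>us. fun_hat (t us) (u us) b) (\<lambda>us. fun_hat (t us) (v us) b)"
proof -
  have "\<exists>d. \<forall>m. analytic \<Gamma> (d m) \<and> (\<forall>us\<in>envs \<Gamma>. mpow (v us) m = mpow (u us) m + d m us)"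
    using analytic_le_mpow[of \<Gamma> u v, OF u] unfolding analytic_le_def by (intro choice) blast
  then obtain d where d: "\<And>m. analytic \<Gamma> (d m)"
    "\<And>m us. us \<in> envs \<Gamma> \<Longrightarrow> mpow (v us) m = mpow (u us) m + d m us" by blast
  show ?thesis
    unfolding analytic_le_def
  proof (intro exI conjI ballI)
    show "analytic \<Gamma> (\<lambda>us. \<Sum>\<^sub>\<infinity>m. t us (PFun m b) * d m us)"
      by (intro analytic_infsum analytic_mult t d(1))
    show "fun_hat (t us) (v us) b = fun_hat (t us) (u us) b + (\<Sum>\<^sub>\<infinity>m. t us (PFun m b) * d m us)"
      if "us \<in> envs \<Gamma>" for us
      by (simp add: fun_hat_def d(2)[OF that] distrib_left infsum_ennreal_add)
  qed
qed

lemma analytic_SUP: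
  assumes "analytic \<Gamma> (g 0)" "\<And>n. analytic_le \<Gamma> (g n) (g (Suc n))"
    and "\<And>us. us \<in> envs \<Gamma> \<Longrightarrow> g 0 us = 0"
  shows "analytic \<Gamma> (\<lambda>us. SUP n::nat. g n us)"
proof -
  have "\<exists>d. \<forall>n. analytic \<Gamma> (d n) \<and> (\<forall>us\<in>envs \<Gamma>. g (Suc n) us = g n us + d n us)"
    using assms(2) unfolding analytic_le_def by (intro choice) blast
  then obtain d where d: "\<And>n. analytic \<Gamma> (d n)"
    "\<And>n us. us \<in> envs \<Gamma> \<Longrightarrow> g (Suc n) us = g n us + d n us" by blast
  show ?thesis
  proof (rule analytic_cong)
    show "analytic \<Gamma> (\<lambda>us. \<Sum>\<^sub>\<infinity>n. d n us)"
      by (intro analytic_infsum d(1))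
    fix us assume us: "us \<in> envs \<Gamma>"
    have "g n us = (\<Sum>k<n. d k us)" for n
      by (induction n) (simp_all add: assms(3)[OF us] d(2)[OF us])
    then show "(SUP n. g n us) = (\<Sum>\<^sub>\<infinity>n. d n us)"
      by (simp add: infsum_ennreal_eq_suminf suminf_eq_SUP)
  qed
qed

lemma incseq_fun_hat_iterates: "incseq (\<lambda>n. (fun_hat t ^^ n) (\<lambda>_. 0) a)"
proof -
  have "(fun_hat t ^^ n) (\<lambda>_. 0) a \<le> (fun_hat t ^^ Suc n) (\<lambda>_. 0) a" for n a
    by (induction n arbitrary: a) (auto intro: fun_hat_mono)
  then show ?thesis by (rule incseq_SucI)
qed

text \<open>Pointwise growth of the iterates says nothing about their coefficients (u^2 \<le> u on
  [0,1]), so the induction shows that each iterate exceeds the previous one by an analytic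
  function.\<close>

lemma analytic_fix:
  assumes t: "\<And>a. analytic \<Gamma> (\<lambda>us. t us a)"
  shows "analytic \<Gamma> (\<lambda>us. SUP n. (fun_hat (t us) ^^ n) (\<lambda>_. 0) a)"
proof (rule analytic_SUP)
  have an: "analytic \<Gamma> (\<lambda>us. (fun_hat (t us) ^^ n) (\<lambda>_. 0) a)" for n a
    by (induction n arbitrary: a) (simp_all add: analytic_const analytic_fun_hat t)
  show "analytic \<Gamma> (\<lambda>us. (fun_hat (t us) ^^ 0) (\<lambda>_. 0) a)" by (rule an)
  show "analytic_le \<Gamma> (\<lambda>us. (fun_hat (t us) ^^ n) (\<lambda>_. 0) a) (\<lambda>us. (fun_hat (t us) ^^ Suc n) (\<lambda>_. 0) a)" for n
  proof (induction n arbitrary: a)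
    case 0
    have "analytic \<Gamma> (\<lambda>us. (fun_hat (t us) ^^ Suc 0) (\<lambda>_. 0) a)" by (rule an)
    then show ?case unfolding analytic_le_def by (intro exI[of _ "\<lambda>us. (fun_hat (t us) ^^ Suc 0) (\<lambda>_. 0) a"]) simp
  next
    case (Suc n)
    have "analytic_le \<Gamma> (\<lambda>us. fun_hat (t us) ((fun_hat (t us) ^^ n) (\<lambda>_. 0)) a)
        (\<lambda>us. fun_hat (t us) ((fun_hat (t us) ^^ Suc n) (\<lambda>_. 0)) a)"
      by (rule analytic_le_fun_hat[OF t an Suc])
    then show ?case by simp
  qed
qed simp

section \<open>The denotational semantics is well defined\<close>

text \<open>The invariant of the induction on typing. It supplies the finiteness from which
  existence and uniqueness at the next constructor are derived.\<close>

definition den_family :: "ty list \<Rightarrow> ty \<Rightarrow> family \<Rightarrow> bool" where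
  "den_family \<Gamma> \<sigma> F \<longleftrightarrow> F \<in> nonneg_families (index \<Gamma> \<sigma>) \<and> (\<forall>us\<in>envs \<Gamma>. hat F us \<in> pcliques \<sigma>)"

lemma in_index: "(\<mu>s, b) \<in> index \<Gamma> \<sigma> \<longleftrightarrow> multiindex \<Gamma> \<mu>s \<and> b \<in> web \<sigma>"
  by (simp add: index_def)

lemma family_unique:
  assumes "F \<in> nonneg_families (index \<Gamma> \<sigma>)" "G \<in> nonneg_families (index \<Gamma> \<sigma>)"
    and "\<And>us. us \<in> envs \<Gamma> \<Longrightarrow> hat F us = hat G us"
    and "\<And>us. us \<in> envs \<Gamma> \<Longrightarrow> hat F us \<in> pcliques \<sigma>"
  shows "F = G"
proof
  fix x :: "pt multiset list \<times> pt"
  obtain \<mu>s b where x: "x = (\<mu>s, b)" by (cases x)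
  show "F x = G x"
  proof (cases "(\<mu>s, b) \<in> index \<Gamma> \<sigma>")
    case False
    then show ?thesis using assms(1,2) by (auto simp: nonneg_families_def x)
  next
    case True
    have "(\<lambda>\<mu>s. F (\<mu>s, b)) \<mu>s = (\<lambda>\<mu>s. G (\<mu>s, b)) \<mu>s \<and> (\<lambda>\<mu>s. F (\<mu>s, b)) \<mu>s < \<infinity>"
    proof (rule series_list_unique[of \<Gamma>])
      show "multiindex \<Gamma> \<mu>s" using True by (simp add: in_index)
      show "series (\<lambda>\<mu>s. F (\<mu>s, b)) us = series (\<lambda>\<mu>s. G (\<mu>s, b)) us" if "us \<in> envs \<Gamma>" for us
        using assms(3)[OF that] by (simp add: hat_series[symmetric])
      show "series (\<lambda>\<mu>s. F (\<mu>s, b)) us < \<infinity>" if "us \<in> envs \<Gamma>" for us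
        using pcliques_finite[OF assms(4)[OF that]] by (simp add: hat_series[symmetric])
    qed
    then show ?thesis by (simp add: x)
  qed
qed

text \<open>Resolves the description in \<open>family_of\<close> for all constructors at once:
  analyticity at each output point gives coefficients, clique values give their finiteness and
  uniqueness.\<close>

lemma family_of_analytic:
  assumes "\<And>us. us \<in> envs \<Gamma> \<Longrightarrow> f us \<in> pcliques \<sigma>" "\<And>b. analytic \<Gamma> (\<lambda>us. f us b)"
  shows "den_family \<Gamma> \<sigma> (family_of \<Gamma> \<sigma> f)" "\<And>us. us \<in> envs \<Gamma> \<Longrightarrow> hat (family_of \<Gamma> \<sigma> f) us = f us"
proof -
  let ?P = "\<lambda>F. F \<in> nonneg_families (index \<Gamma> \<sigma>) \<and> (\<forall>us\<in>envs \<Gamma>. hat F us = f us)"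
  have "\<exists>c. \<forall>b. \<forall>us\<in>envs \<Gamma>. f us b = series (c b) us"
    using assms(2) unfolding analytic_def by (intro choice) blast
  then obtain c where c: "\<And>b us. us \<in> envs \<Gamma> \<Longrightarrow> f us b = series (c b) us" by blast
  \<comment> \<open>The cut to the index set leaves the function on environments unchanged.\<close>
  define F where "F = (\<lambda>(\<mu>s, b). if (\<mu>s, b) \<in> index \<Gamma> \<sigma> then c b \<mu>s else 0)"
  have hatF: "hat F us = f us" if us: "us \<in> envs \<Gamma>" for us
  proof
    fix b
    show "hat F us b = f us b"
    proof (cases "b \<in> web \<sigma>")
      case True
      then show ?thesis
        using series_restrict[OF us, of "c b"] by (simp add: hat_series F_def in_index c[OF us])
    next
      case False
      then show ?thesis
        using pcliques_outside[OF assms(1)[OF us]] by (simp add: hat_series F_def in_index series_def)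
    qed
  qed
  have finF: "F x < \<infinity>" for x
  proof (cases "x \<in> index \<Gamma> \<sigma>")
    case True
    then obtain \<mu>s b where x: "x = (\<mu>s, b)" "multiindex \<Gamma> \<mu>s" by (cases x) (auto simp: in_index)
    have "series (c b) us < \<infinity>" if "us \<in> envs \<Gamma>" for us
      using pcliques_finite[OF assms(1)[OF that], of b] by (simp add: c[OF that])
    \<comment> \<open>Uniqueness with equal sides, used for its finiteness part.\<close>
    then have "c b \<mu>s < \<infinity>"
      using series_list_unique[of \<Gamma> "c b" "c b" \<mu>s] x(2) by simp
    then show ?thesis by (simp add: F_def x(1))
  qed (auto simp: F_def split: prod.splits)
  have "F x = 0" if "x \<notin> index \<Gamma> \<sigma>" for x
    using that by (auto simp: F_def split: prod.splits)
  then have "?P F"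
    using hatF finF by (simp add: nonneg_families_def)
  moreover have "G = F" if "?P G" for G
    using that \<open>?P F\<close> assms(1) by (intro family_unique[of G \<Gamma> \<sigma> F]) auto
  ultimately have "?P (family_of \<Gamma> \<sigma> f)"
    unfolding family_of_def by (rule theI)
  then show "den_family \<Gamma> \<sigma> (family_of \<Gamma> \<sigma> f)" "\<And>us. us \<in> envs \<Gamma> \<Longrightarrow> hat (family_of \<Gamma> \<sigma> f) us = f us"
    using assms(1) by (auto simp: den_family_def)
qed

section \<open>Inversion and uniqueness of typing\<close>

inductive_cases typing_NumE: "\<Gamma> \<turnstile> Num n : \<sigma>"
inductive_cases typing_VarE: "\<Gamma> \<turnstile> Var i : \<sigma>"
inductive_cases typing_CoinE: "\<Gamma> \<turnstile> Coin p : \<sigma>"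
inductive_cases typing_SuccE: "\<Gamma> \<turnstile> Succ M : \<sigma>"
inductive_cases typing_IfzE: "\<Gamma> \<turnstile> Ifz M P R : \<sigma>"
inductive_cases typing_LamE: "\<Gamma> \<turnstile> Lam \<tau> M : \<sigma>"
inductive_cases typing_AppE: "\<Gamma> \<turnstile> App M N : \<sigma>"
inductive_cases typing_FixE: "\<Gamma> \<turnstile> Fix M : \<sigma>"

lemmas typing_elims = typing_NumE typing_VarE typing_CoinE typing_SuccE typing_IfzE typing_LamE
  typing_AppE typing_FixE

lemma typing_unique: "\<Gamma> \<turnstile> M : \<sigma> \<Longrightarrow> \<Gamma> \<turnstile> M : \<tau> \<Longrightarrow> \<sigma> = \<tau>"
  by (induction arbitrary: \<tau> rule: typing.induct) (erule typing_elims; blast)+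

lemma type_of_eq: "\<Gamma> \<turnstile> M : \<sigma> \<Longrightarrow> type_of \<Gamma> M = \<sigma>"
  unfolding type_of_def using typing_unique by blast

lemma infsum_dirac [simp]: "(\<Sum>\<^sub>\<infinity>n. dirac k (PNat n)) = 1"
  by (simp add: dirac_def infsum_ennreal_delta)

lemma dirac_Num [simp]: "dirac n (PNat m) = (if m = n then 1 else 0)"
  by (simp add: dirac_def)

section \<open>Operations on cliques interpreting the term constructors\<close>

definition coin_vec :: "rat \<Rightarrow> pvec" where
  "coin_vec p = (\<lambda>a. ennreal (of_rat p) * dirac 0 a + ennreal (of_rat (1 - p)) * dirac 1 a)"

definition succ_vec :: "pvec \<Rightarrow> pvec" where
  "succ_vec u = (\<lambda>a. \<Sum>\<^sub>\<infinity>n. u (PNat n) * dirac (n + 1) a)"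

definition ifz_vec :: "pvec \<Rightarrow> pvec \<Rightarrow> (nat \<Rightarrow> pvec) \<Rightarrow> pvec" where
  "ifz_vec u q r = (\<lambda>a. u (PNat 0) * q a + (\<Sum>\<^sub>\<infinity>n. u (PNat (n + 1)) * r n a))"

definition fix_vec :: "pvec \<Rightarrow> pvec" where
  "fix_vec t = (SUP n. (fun_hat t ^^ n) (\<lambda>a. 0))"

text \<open>Closed form of the vector selected by the description in the clause for abstractions:
  the first multi-index of \<open>F\<close> moves into the point of the web.\<close>

definition lam_vec :: "family \<Rightarrow> pvec list \<Rightarrow> pvec" where
  "lam_vec F us = (\<lambda>a. case a of PNat n \<Rightarrow> 0 | PFun \<mu> b \<Rightarrow> series (\<lambda>\<mu>s. F (\<mu> # \<mu>s, b)) us)"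

lemma infsum_nat_split: "(\<Sum>\<^sub>\<infinity>n. f n) = f 0 + (\<Sum>\<^sub>\<infinity>n. f (Suc n) :: ennreal)"
proof -
  have "(\<lambda>n. f (Suc n)) sums (\<Sum>\<^sub>\<infinity>n. f (Suc n))"
    by (simp add: infsum_ennreal_eq_suminf summable_sums)
  then have "f sums ((\<Sum>\<^sub>\<infinity>n. f (Suc n)) + f 0)"
    by (rule sums_Suc)
  then show ?thesis
    by (simp add: infsum_ennreal_eq_suminf sums_unique[symmetric] add.commute)
qed

text \<open>The branches become one sequence indexed by the value of the guard, so the conditional
  is a subconvex combination with weights \<open>u\<close>, and visibly linear in
  \<open>u\<close>.\<close>

lemma ifz_vec_eq: "ifz_vec u q r = (\<lambda>a. \<Sum>\<^sub>\<infinity>n. u (PNat n) * (case n of 0 \<Rightarrow> q | Suc m \<Rightarrow> r m) a)"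
  unfolding ifz_vec_def by (rule ext) (subst infsum_nat_split, simp)

lemma coin_vec_pcliques:
  assumes "0 \<le> p" "p \<le> 1" shows "coin_vec p \<in> pcliques TNat"
proof -
  have "(0::real) \<le> of_rat p" "(0::real) \<le> of_rat (1 - p)"
    using assms by (simp_all add: zero_le_of_rat_iff)
  then have "ennreal (of_rat p) + ennreal (of_rat (1 - p)) = 1"
    by (simp add: ennreal_plus[symmetric] of_rat_add[symmetric] del: ennreal_plus)
  then have "(\<Sum>\<^sub>\<infinity>n. coin_vec p (PNat n)) = 1"
    unfolding coin_vec_def infsum_ennreal_add infsum_ennreal_cmult infsum_dirac by simp
  moreover have "coin_vec p a < \<infinity>" for a
    by (simp add: coin_vec_def dirac_def)
  moreover have "coin_vec p a = 0" if "a \<notin> range PNat" for a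
    using that by (auto simp: coin_vec_def dirac_def)
  ultimately show ?thesis by (simp add: nonneg_families_def)
qed

lemma succ_vec_pcliques: "u \<in> pcliques TNat \<Longrightarrow> succ_vec u \<in> pcliques TNat"
  unfolding succ_vec_def by (rule pcliques_convex[OF _ dirac_pcliques]) simp

lemma ifz_vec_pcliques:
  assumes "u \<in> pcliques TNat" "q \<in> pcliques \<sigma>" "\<And>n. r n \<in> pcliques \<sigma>"
  shows "ifz_vec u q r \<in> pcliques \<sigma>"
  unfolding ifz_vec_eq
  by (rule pcliques_convex) (use assms in \<open>auto split: nat.split\<close>)

lemma fix_vec_apply: "fix_vec t a = (SUP n. (fun_hat t ^^ n) (\<lambda>_. 0) a)"
  by (simp add: fix_vec_def SUP_apply image_image)

lemma fun_hat_iterate_pcliques: "t \<in> pcliques (TFun \<sigma> \<sigma>) \<Longrightarrow> (fun_hat t ^^ n) (\<lambda>_. 0) \<in> pcliques \<sigma>"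
  by (induction n) (simp_all add: zero_pcliques)

lemma fix_vec_pcliques: "t \<in> pcliques (TFun \<sigma> \<sigma>) \<Longrightarrow> fix_vec t \<in> pcliques \<sigma>"
  unfolding fix_vec_apply[abs_def]
  by (rule pcliques_SUP[OF incseq_fun_hat_iterates fun_hat_iterate_pcliques])

lemma fun_hat_lam_vec: "fun_hat (lam_vec F us) v = hat F (v # us)"
  by (rule ext) (simp add: fun_hat_def lam_vec_def hat_series series_Cons)

text \<open>Extensionality: at each output point a clique of function type is a power series, and
  its values on cliques determine the coefficients. Abstractions owe their uniqueness to it.\<close>

lemma pcliques_fun_eqI:
  assumes "t \<in> pcliques (TFun \<sigma> \<tau>)" "s \<in> pcliques (TFun \<sigma> \<tau>)"
    and "\<And>v. v \<in> pcliques \<sigma> \<Longrightarrow> fun_hat t v = fun_hat s v"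
  shows "t = s"
proof
  fix a
  show "t a = s a"
  proof (cases "a \<in> web (TFun \<sigma> \<tau>)")
    case True
    then obtain \<mu> b where a: "a = PFun \<mu> b" "set_mset \<mu> \<subseteq> web \<sigma>" by auto
    have "(\<lambda>\<mu>. t (PFun \<mu> b)) \<mu> = (\<lambda>\<mu>. s (PFun \<mu> b)) \<mu>"
    proof (rule pcliques_series_unique[OF _ _ a(2)])
      fix u assume u: "u \<in> pcliques \<sigma>"
      show "(\<Sum>\<^sub>\<infinity>\<mu>. t (PFun \<mu> b) * mpow u \<mu>) = (\<Sum>\<^sub>\<infinity>\<mu>. s (PFun \<mu> b) * mpow u \<mu>)"
        using fun_cong[OF assms(3)[OF u], of b] by (simp add: fun_hat_def)
      have "fun_hat t u \<in> pcliques \<tau>" using assms(1) u by simp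
      from pcliques_finite[OF this, of b] show "(\<Sum>\<^sub>\<infinity>\<mu>. t (PFun \<mu> b) * mpow u \<mu>) < \<infinity>"
        by (simp add: fun_hat_def)
    qed
    then show ?thesis by (simp add: a(1))
  next
    case False
    then show ?thesis using pcliques_outside[OF assms(1)] pcliques_outside[OF assms(2)] by metis
  qed
qed

lemma lam_vec_pcliques:
  assumes F: "den_family (\<sigma> # \<Gamma>) \<tau> F" and us: "us \<in> envs \<Gamma>"
  shows "lam_vec F us \<in> pcliques (TFun \<sigma> \<tau>)"
proof -
  have hat: "fun_hat (lam_vec F us) v \<in> pcliques \<tau>" if "v \<in> pcliques \<sigma>" for v
    using F us that by (simp add: fun_hat_lam_vec den_family_def)
  have out: "lam_vec F us a = 0" if "a \<notin> web (TFun \<sigma> \<tau>)" for a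
  proof (cases a)
    case (PFun \<mu> b)
    then have "F (\<mu> # \<mu>s, b) = 0" for \<mu>s
      using F that by (auto simp: den_family_def nonneg_families_def in_index)
    then show ?thesis by (simp add: lam_vec_def PFun series_def)
  qed (simp add: lam_vec_def)
  \<comment> \<open>An entry is the value of a series in \<open>us\<close> and could be infinite a
    priori; it is also a coefficient of a series in \<open>v\<close> that is finite on
    cliques.\<close>
  have "lam_vec F us a < \<infinity>" for a
  proof (cases "a \<in> web (TFun \<sigma> \<tau>)")
    case True
    then obtain \<mu> b where a: "a = PFun \<mu> b" "set_mset \<mu> \<subseteq> web \<sigma>" by auto
    have "(\<lambda>\<mu>. lam_vec F us (PFun \<mu> b)) \<mu> < \<infinity>"
    proof (rule series_coeff_finite[OF _ a(2)])
      fix u assume "u \<in> pcliques \<sigma>"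
      from pcliques_finite[OF hat[OF this], of b]
      show "(\<Sum>\<^sub>\<infinity>\<mu>. lam_vec F us (PFun \<mu> b) * mpow u \<mu>) < \<infinity>"
        by (simp add: fun_hat_def)
    qed
    then show ?thesis by (simp add: a(1))
  qed (simp add: out)
  then show ?thesis using hat out by (simp add: nonneg_families_def)
qed

text \<open>This clause nests a description inside that of \<open>family_of\<close>. Analyticity
  becomes visible once the inner one is identified with \<open>lam_vec\<close>, whose entries are
  series in \<open>us\<close>.\<close>

lemma sem_Lam_eq:
  assumes "\<Gamma> \<turnstile> Lam \<sigma> P : TFun \<sigma> \<tau>" "den_family (\<sigma> # \<Gamma>) \<tau> (sem (\<sigma> # \<Gamma>) P)"
  shows "den_family \<Gamma> (TFun \<sigma> \<tau>) (sem \<Gamma> (Lam \<sigma> P))"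
    "\<And>us. us \<in> envs \<Gamma> \<Longrightarrow> hat (sem \<Gamma> (Lam \<sigma> P)) us = lam_vec (sem (\<sigma> # \<Gamma>) P) us"
proof -
  let ?F = "sem (\<sigma> # \<Gamma>) P"
  let ?f = "\<lambda>us. THE t. t \<in> pcliques (TFun \<sigma> \<tau>) \<and> (\<forall>v\<in>pcliques \<sigma>. fun_hat t v = hat ?F (v # us))"
  have f: "?f us = lam_vec ?F us" if us: "us \<in> envs \<Gamma>" for us
  proof (rule the_equality)
    show "lam_vec ?F us \<in> pcliques (TFun \<sigma> \<tau>) \<and> (\<forall>v\<in>pcliques \<sigma>. fun_hat (lam_vec ?F us) v = hat ?F (v # us))"
      using lam_vec_pcliques[OF assms(2) us] by (simp add: fun_hat_lam_vec)
    then show "t = lam_vec ?F us"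
      if "t \<in> pcliques (TFun \<sigma> \<tau>) \<and> (\<forall>v\<in>pcliques \<sigma>. fun_hat t v = hat ?F (v # us))" for t
      using that by (intro pcliques_fun_eqI[of t \<sigma> \<tau>]) (simp_all del: pcliques.simps)
  qed
  have mem: "?f us \<in> pcliques (TFun \<sigma> \<tau>)" if "us \<in> envs \<Gamma>" for us
    unfolding f[OF that] by (rule lam_vec_pcliques[OF assms(2) that])
  have an: "analytic \<Gamma> (\<lambda>us. ?f us b)" for b
  proof (rule analytic_cong)
    show "?f us b = lam_vec ?F us b" if "us \<in> envs \<Gamma>" for us by (simp only: f[OF that])
    show "analytic \<Gamma> (\<lambda>us. lam_vec ?F us b)"
      by (cases b) (simp_all add: lam_vec_def analytic_const analytic_series)
  qed
  have s: "sem \<Gamma> (Lam \<sigma> P) = family_of \<Gamma> (TFun \<sigma> \<tau>) ?f"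
    by (simp add: type_of_eq[OF assms(1)])
  show "den_family \<Gamma> (TFun \<sigma> \<tau>) (sem \<Gamma> (Lam \<sigma> P))"
    unfolding s by (rule family_of_analytic(1)[OF mem an])
  show "hat (sem \<Gamma> (Lam \<sigma> P)) us = lam_vec ?F us" if "us \<in> envs \<Gamma>" for us
    unfolding s f[OF that, symmetric] by (rule family_of_analytic(2)[OF mem an that])
qed

section \<open>Semantic equations of the remaining constructors\<close>

lemma sem_eqI:
  assumes "\<Gamma> \<turnstile> M : \<sigma>" "sem \<Gamma> M = family_of \<Gamma> (type_of \<Gamma> M) f"
    and "\<And>us. us \<in> envs \<Gamma> \<Longrightarrow> f us \<in> pcliques \<sigma>" "\<And>b. analytic \<Gamma> (\<lambda>us. f us b)"
  shows "den_family \<Gamma> \<sigma> (sem \<Gamma> M) \<and> (\<forall>us\<in>envs \<Gamma>. hat (sem \<Gamma> M) us = f us)"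
  unfolding assms(2) type_of_eq[OF assms(1)] using family_of_analytic[OF assms(3,4)] by blast

lemma hat_pcliques: "den_family \<Gamma> \<sigma> F \<Longrightarrow> us \<in> envs \<Gamma> \<Longrightarrow> hat F us \<in> pcliques \<sigma>"
  by (simp add: den_family_def)

lemma sem_Var_eq:
  assumes "\<Gamma> \<turnstile> Var i : \<sigma>"
  shows "den_family \<Gamma> \<sigma> (sem \<Gamma> (Var i)) \<and> (\<forall>us\<in>envs \<Gamma>. hat (sem \<Gamma> (Var i)) us = us ! i)"
proof -
  from assms have "i < length \<Gamma>" "\<Gamma> ! i = \<sigma>" by (auto elim: typing.cases)
  then show ?thesis
    by (intro sem_eqI assms) (auto simp: envs_nth analytic_nth)
qed

lemma sem_Num_eq:
  "den_family \<Gamma> TNat (sem \<Gamma> (Num n)) \<and> (\<forall>us\<in>envs \<Gamma>. hat (sem \<Gamma> (Num n)) us = dirac n)"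
  by (rule sem_eqI) (auto intro: T_Num simp: analytic_const dirac_pcliques simp del: pcliques.simps)

lemma sem_Coin_eq:
  assumes "0 \<le> p" "p \<le> 1"
  shows "den_family \<Gamma> TNat (sem \<Gamma> (Coin p)) \<and> (\<forall>us\<in>envs \<Gamma>. hat (sem \<Gamma> (Coin p)) us = coin_vec p)"
proof (rule sem_eqI[OF T_Coin[OF assms]])
  show "sem \<Gamma> (Coin p) = family_of \<Gamma> (type_of \<Gamma> (Coin p)) (\<lambda>us. coin_vec p)"
    by (simp add: coin_vec_def)
qed (rule coin_vec_pcliques[OF assms], rule analytic_const)

lemma sem_Succ_eq:
  assumes "\<Gamma> \<turnstile> P : TNat" "den_family \<Gamma> TNat (sem \<Gamma> P)"
  shows "den_family \<Gamma> TNat (sem \<Gamma> (Succ P)) \<and>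
    (\<forall>us\<in>envs \<Gamma>. hat (sem \<Gamma> (Succ P)) us = succ_vec (hat (sem \<Gamma> P) us))"
proof (rule sem_eqI[OF T_Succ[OF assms(1)]])
  show "sem \<Gamma> (Succ P) = family_of \<Gamma> (type_of \<Gamma> (Succ P)) (\<lambda>us. succ_vec (hat (sem \<Gamma> P) us))"
    by (simp add: succ_vec_def)
  show "succ_vec (hat (sem \<Gamma> P) us) \<in> pcliques TNat" if "us \<in> envs \<Gamma>" for us
    by (intro succ_vec_pcliques hat_pcliques[OF assms(2) that])
  show "analytic \<Gamma> (\<lambda>us. succ_vec (hat (sem \<Gamma> P) us) b)" for b
    unfolding succ_vec_def by (intro analytic_infsum analytic_mult analytic_hat analytic_const)
qed

lemma sem_Ifz_eq:
  assumes "\<Gamma> \<turnstile> P : TNat" "\<Gamma> \<turnstile> Q : \<sigma>" "TNat # \<Gamma> \<turnstile> R : \<sigma>"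
    "den_family \<Gamma> TNat (sem \<Gamma> P)" "den_family \<Gamma> \<sigma> (sem \<Gamma> Q)" "den_family (TNat # \<Gamma>) \<sigma> (sem (TNat # \<Gamma>) R)"
  shows "den_family \<Gamma> \<sigma> (sem \<Gamma> (Ifz P Q R)) \<and>
    (\<forall>us\<in>envs \<Gamma>. hat (sem \<Gamma> (Ifz P Q R)) us =
      ifz_vec (hat (sem \<Gamma> P) us) (hat (sem \<Gamma> Q) us) (\<lambda>n. hat (sem (TNat # \<Gamma>) R) (dirac n # us)))"
    (is "_ \<and> (\<forall>us\<in>envs \<Gamma>. _ = ?f us)")
proof (rule sem_eqI[OF T_Ifz[OF assms(1-3)]])
  show "sem \<Gamma> (Ifz P Q R) = family_of \<Gamma> (type_of \<Gamma> (Ifz P Q R)) ?f"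
    by (simp add: ifz_vec_def)
  show "?f us \<in> pcliques \<sigma>" if "us \<in> envs \<Gamma>" for us
    by (intro ifz_vec_pcliques hat_pcliques[OF assms(4) that] hat_pcliques[OF assms(5) that]
        hat_pcliques[OF assms(6)]) (simp add: that dirac_pcliques del: pcliques.simps)
  show "analytic \<Gamma> (\<lambda>us. ?f us b)" for b
    unfolding ifz_vec_def
    by (intro analytic_add analytic_infsum analytic_mult analytic_hat analytic_hat_Cons)
qed

lemma sem_App_eq:
  assumes "\<Gamma> \<turnstile> P : TFun \<sigma> \<tau>" "\<Gamma> \<turnstile> Q : \<sigma>"
    "den_family \<Gamma> (TFun \<sigma> \<tau>) (sem \<Gamma> P)" "den_family \<Gamma> \<sigma> (sem \<Gamma> Q)"
  shows "den_family \<Gamma> \<tau> (sem \<Gamma> (App P Q)) \<and>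
    (\<forall>us\<in>envs \<Gamma>. hat (sem \<Gamma> (App P Q)) us = fun_hat (hat (sem \<Gamma> P) us) (hat (sem \<Gamma> Q) us))"
proof (rule sem_eqI[OF T_App[OF assms(1,2)]])
  show "fun_hat (hat (sem \<Gamma> P) us) (hat (sem \<Gamma> Q) us) \<in> pcliques \<tau>" if "us \<in> envs \<Gamma>" for us
    using hat_pcliques[OF assms(3) that] hat_pcliques[OF assms(4) that] by simp
  show "analytic \<Gamma> (\<lambda>us. fun_hat (hat (sem \<Gamma> P) us) (hat (sem \<Gamma> Q) us) b)" for b
    by (intro analytic_fun_hat analytic_hat)
qed simp

lemma sem_Fix_eq:
  assumes "\<Gamma> \<turnstile> P : TFun \<sigma> \<sigma>" "den_family \<Gamma> (TFun \<sigma> \<sigma>) (sem \<Gamma> P)"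
  shows "den_family \<Gamma> \<sigma> (sem \<Gamma> (Fix P)) \<and>
    (\<forall>us\<in>envs \<Gamma>. hat (sem \<Gamma> (Fix P)) us = fix_vec (hat (sem \<Gamma> P) us))"
proof (rule sem_eqI[OF T_Fix[OF assms(1)]])
  show "fix_vec (hat (sem \<Gamma> P) us) \<in> pcliques \<sigma>" if "us \<in> envs \<Gamma>" for us
    by (intro fix_vec_pcliques hat_pcliques[OF assms(2) that])
  show "analytic \<Gamma> (\<lambda>us. fix_vec (hat (sem \<Gamma> P) us) b)" for b
    unfolding fix_vec_apply by (intro analytic_fix analytic_hat)
qed (simp add: fix_vec_def)

lemma sem_den_family: "\<Gamma> \<turnstile> M : \<sigma> \<Longrightarrow> den_family \<Gamma> \<sigma> (sem \<Gamma> M)"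
proof (induction rule: typing.induct)
  case T_Num
  show ?case by (rule conjunct1[OF sem_Num_eq])
next
  case T_Var
  then show ?case by (intro conjunct1[OF sem_Var_eq] typing.T_Var)
next
  case T_Coin
  then show ?case by (rule conjunct1[OF sem_Coin_eq])
next
  case T_Succ
  then show ?case by (rule conjunct1[OF sem_Succ_eq])
next
  case T_Ifz
  then show ?case by (intro conjunct1[OF sem_Ifz_eq])
next
  case T_Lam
  then show ?case by (intro sem_Lam_eq(1) typing.T_Lam)
next
  case T_App
  then show ?case by (intro conjunct1[OF sem_App_eq])
next
  case T_Fix
  then show ?case by (rule conjunct1[OF sem_Fix_eq])
qed

section \<open>Denotations as functions on environments\<close>

definition den :: "ty list \<Rightarrow> tm \<Rightarrow> pvec list \<Rightarrow> pvec" where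
  "den \<Gamma> M us = hat (sem \<Gamma> M) us"

lemma den_pcliques: "\<Gamma> \<turnstile> M : \<sigma> \<Longrightarrow> us \<in> envs \<Gamma> \<Longrightarrow> den \<Gamma> M us \<in> pcliques \<sigma>"
  unfolding den_def by (rule hat_pcliques[OF sem_den_family])

lemma den_Num: "us \<in> envs \<Gamma> \<Longrightarrow> den \<Gamma> (Num n) us = dirac n"
  unfolding den_def by (rule bspec[OF conjunct2[OF sem_Num_eq]])

lemma den_Var: "\<Gamma> \<turnstile> Var i : \<sigma> \<Longrightarrow> us \<in> envs \<Gamma> \<Longrightarrow> den \<Gamma> (Var i) us = us ! i"
  unfolding den_def by (rule bspec[OF conjunct2[OF sem_Var_eq]])

lemma den_Coin: "0 \<le> p \<Longrightarrow> p \<le> 1 \<Longrightarrow> us \<in> envs \<Gamma> \<Longrightarrow> den \<Gamma> (Coin p) us = coin_vec p"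
  unfolding den_def by (rule bspec[OF conjunct2[OF sem_Coin_eq]])

lemma den_Succ: "\<Gamma> \<turnstile> P : TNat \<Longrightarrow> us \<in> envs \<Gamma> \<Longrightarrow> den \<Gamma> (Succ P) us = succ_vec (den \<Gamma> P us)"
  unfolding den_def by (rule bspec[OF conjunct2[OF sem_Succ_eq[OF _ sem_den_family]]])

lemma den_Ifz:
  "\<Gamma> \<turnstile> P : TNat \<Longrightarrow> \<Gamma> \<turnstile> Q : \<sigma> \<Longrightarrow> TNat # \<Gamma> \<turnstile> R : \<sigma> \<Longrightarrow> us \<in> envs \<Gamma> \<Longrightarrow>
    den \<Gamma> (Ifz P Q R) us =
      ifz_vec (den \<Gamma> P us) (den \<Gamma> Q us) (\<lambda>n. den (TNat # \<Gamma>) R (dirac n # us))"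
  unfolding den_def
  by (rule bspec[OF conjunct2[OF sem_Ifz_eq[OF _ _ _ sem_den_family sem_den_family sem_den_family]]])

lemma den_App:
  "\<Gamma> \<turnstile> P : TFun \<sigma> \<tau> \<Longrightarrow> \<Gamma> \<turnstile> Q : \<sigma> \<Longrightarrow> us \<in> envs \<Gamma> \<Longrightarrow>
    den \<Gamma> (App P Q) us = fun_hat (den \<Gamma> P us) (den \<Gamma> Q us)"
  unfolding den_def
  by (rule bspec[OF conjunct2[OF sem_App_eq[OF _ _ sem_den_family sem_den_family]]])

lemma den_Fix:
  "\<Gamma> \<turnstile> P : TFun \<sigma> \<sigma> \<Longrightarrow> us \<in> envs \<Gamma> \<Longrightarrow> den \<Gamma> (Fix P) us = fix_vec (den \<Gamma> P us)"
  unfolding den_def by (rule bspec[OF conjunct2[OF sem_Fix_eq[OF _ sem_den_family]]])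

lemma fun_hat_den_Lam:
  "\<sigma> # \<Gamma> \<turnstile> P : \<tau> \<Longrightarrow> us \<in> envs \<Gamma> \<Longrightarrow>
    fun_hat (den \<Gamma> (Lam \<sigma> P) us) v = den (\<sigma> # \<Gamma>) P (v # us)"
  unfolding den_def
  by (subst sem_Lam_eq(2)[OF T_Lam sem_den_family]) (assumption | rule fun_hat_lam_vec)+

lemma sem_eq_if_den_eq:
  assumes "\<Gamma> \<turnstile> M : \<sigma>" "\<Gamma> \<turnstile> M' : \<sigma>" "\<And>us. us \<in> envs \<Gamma> \<Longrightarrow> den \<Gamma> M us = den \<Gamma> M' us"
  shows "sem \<Gamma> M = sem \<Gamma> M'"
  using sem_den_family[OF assms(1)] sem_den_family[OF assms(2)] assms(3)
  unfolding den_family_def den_def by (intro family_unique[of _ \<Gamma> \<sigma>]) blast+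

section \<open>Contexts and substitution\<close>

lemma envs_append: "us \<in> envs \<Gamma> \<Longrightarrow> vs \<in> envs \<Delta> \<Longrightarrow> us @ vs \<in> envs (\<Gamma> @ \<Delta>)"
  by (simp add: envs_def list_all2_appendI)

lemma envs_appendE:
  assumes "us \<in> envs (\<Gamma> @ \<Delta>)"
  obtains us1 us2 where "us = us1 @ us2" "us1 \<in> envs \<Gamma>" "us2 \<in> envs \<Delta>"
  using assms by (auto simp: envs_def list_all2_append2)

text \<open>The added types stand at the outer end of the context and get the largest indices, so
  \<open>M\<close> is not shifted.\<close>

lemma typing_weaken: "\<Gamma> \<turnstile> M : \<sigma> \<Longrightarrow> \<Gamma> @ \<Delta> \<turnstile> M : \<sigma>"
proof (induction rule: typing.induct)
  case (T_Var i \<Gamma> \<sigma>)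
  then show ?case by (intro typing.T_Var) (simp_all add: nth_append)
qed (auto intro: typing.intros)

lemma den_weaken:
  assumes "\<Gamma> \<turnstile> M : \<sigma>" "us \<in> envs \<Gamma>" "vs \<in> envs \<Delta>"
  shows "den (\<Gamma> @ \<Delta>) M (us @ vs) = den \<Gamma> M us"
  using assms(1,2)
proof (induction arbitrary: us rule: typing.induct)
  case (T_Num \<Gamma> n)
  then show ?case by (simp add: den_Num envs_append[OF _ assms(3)])
next
  case (T_Var i \<Gamma> \<sigma>)
  note t = typing.T_Var[OF T_Var.hyps]
  show ?case
    using T_Var.hyps envs_length[OF T_Var.prems]
    by (simp add: den_Var[OF t T_Var.prems] nth_append
        den_Var[OF typing_weaken[OF t] envs_append[OF T_Var.prems assms(3)]])
next
  case (T_Coin p \<Gamma>)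
  then show ?case by (simp add: den_Coin envs_append[OF _ assms(3)])
next
  case (T_Succ \<Gamma> M)
  then show ?case
    by (simp add: den_Succ den_Succ[OF typing_weaken] envs_append[OF _ assms(3)])
next
  case (T_Ifz \<Gamma> M P \<sigma> R)
  have "TNat # (\<Gamma> @ \<Delta>) \<turnstile> R : \<sigma>" using typing_weaken[OF T_Ifz.hyps(3)] by simp
  moreover have "den (TNat # (\<Gamma> @ \<Delta>)) R (dirac n # (us @ vs)) = den (TNat # \<Gamma>) R (dirac n # us)" for n
    using T_Ifz.IH(3)[of "dirac n # us"] T_Ifz.prems dirac_pcliques[of n] by simp
  ultimately show ?case
    using T_Ifz
    by (simp add: den_Ifz den_Ifz[OF typing_weaken typing_weaken] envs_append[OF _ assms(3)])
next
  case (T_Lam \<sigma> \<Gamma> M \<tau>)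
  have M: "\<sigma> # (\<Gamma> @ \<Delta>) \<turnstile> M : \<tau>" using typing_weaken[OF T_Lam.hyps] by simp
  note us = T_Lam.prems envs_append[OF T_Lam.prems assms(3)]
  show ?case
  \<comment> \<open>Compared by their values, where the induction hypothesis applies with a longer
    environment.\<close>
  proof (rule pcliques_fun_eqI)
    show "den (\<Gamma> @ \<Delta>) (Lam \<sigma> M) (us @ vs) \<in> pcliques (TFun \<sigma> \<tau>)"
      by (intro den_pcliques typing.T_Lam M us)
    show "den \<Gamma> (Lam \<sigma> M) us \<in> pcliques (TFun \<sigma> \<tau>)"
      by (intro den_pcliques typing.T_Lam T_Lam.hyps us)
    fix v assume "v \<in> pcliques \<sigma>"
    then show "fun_hat (den (\<Gamma> @ \<Delta>) (Lam \<sigma> M) (us @ vs)) v = fun_hat (den \<Gamma> (Lam \<sigma> M) us) v"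
      using T_Lam.IH[of "v # us"] us
      by (simp add: fun_hat_den_Lam[OF M] fun_hat_den_Lam[OF T_Lam.hyps])
  qed
next
  case (T_App \<Gamma> M \<sigma> \<tau> N)
  then show ?case
    by (simp add: den_App den_App[OF typing_weaken typing_weaken] envs_append[OF _ assms(3)])
next
  case (T_Fix \<Gamma> M \<sigma>)
  then show ?case
    by (simp add: den_Fix den_Fix[OF typing_weaken] envs_append[OF _ assms(3)])
qed

lemma den_closed: "[] \<turnstile> N : \<sigma> \<Longrightarrow> us \<in> envs \<Gamma> \<Longrightarrow> den \<Gamma> N us = den [] N []"
  using den_weaken[of "[]" N \<sigma> "[]" us \<Gamma>] by simp

lemma typing_closed: "[] \<turnstile> N : \<sigma> \<Longrightarrow> \<Gamma> \<turnstile> N : \<sigma>"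
  using typing_weaken[of "[]" N \<sigma> \<Gamma>] by simp

lemma fill_typing:
  assumes "octyping \<Delta> \<tau> \<Gamma> C \<sigma>" "\<Delta> \<turnstile> M : \<tau>"
  shows "\<Gamma> \<turnstile> fill C M : \<sigma>"
  using assms(1)
  by induction (auto intro: typing.intros typing_weaken assms(2))

text \<open>A clause of \<open>sem\<close> sees subterms only through their families, and the whole
  term otherwise only through its type; typability makes the types agree.\<close>

lemma sem_fill_cong:
  assumes "octyping \<Delta> \<tau> \<Gamma> C \<sigma>" "\<Delta> \<turnstile> M : \<tau>" "\<Delta> \<turnstile> M' : \<tau>" "sem \<Delta> M = sem \<Delta> M'"
  shows "sem \<Gamma> (fill C M) = sem \<Gamma> (fill C M')"
proof -
  have ty: "type_of \<Gamma> (fill C M) = type_of \<Gamma> (fill C M')" if "octyping \<Delta> \<tau> \<Gamma> C \<sigma>" for \<Gamma> C \<sigma>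
    using type_of_eq[OF fill_typing[OF that assms(2)]] type_of_eq[OF fill_typing[OF that assms(3)]] by simp
  show ?thesis
    using assms(1)
  proof induction
    case (C_Hole \<Gamma>')
    \<comment> \<open>A hole may lie in a context extending \<Delta> outwards. The functions there
      depend only on the part for \<Delta>, where they agree, and they determine the
      families.\<close>
    have "sem (\<Delta> @ \<Gamma>') M = sem (\<Delta> @ \<Gamma>') M'"
    proof (rule sem_eq_if_den_eq)
      show "\<Delta> @ \<Gamma>' \<turnstile> M : \<tau>" "\<Delta> @ \<Gamma>' \<turnstile> M' : \<tau>" by (intro typing_weaken assms)+
      fix us assume "us \<in> envs (\<Delta> @ \<Gamma>')"
      then obtain us1 us2 where us: "us = us1 @ us2" "us1 \<in> envs \<Delta>" "us2 \<in> envs \<Gamma>'"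
        by (rule envs_appendE)
      have "den \<Delta> M us1 = den \<Delta> M' us1" by (simp add: den_def assms(4))
      then show "den (\<Delta> @ \<Gamma>') M us = den (\<Delta> @ \<Gamma>') M' us"
        by (simp add: us(1) den_weaken[OF assms(2) us(2,3)] den_weaken[OF assms(3) us(2,3)])
    qed
    then show ?case by simp
  next
    case (C_Succ \<Gamma> C)
    then show ?case using ty[OF octyping.C_Succ[OF C_Succ.hyps]] by simp
  next
    case (C_Ifz \<Gamma> C D \<sigma> E)
    then show ?case using ty[OF octyping.C_Ifz[OF C_Ifz.hyps]] by simp
  next
    case (C_Lam \<sigma> \<Gamma> C \<sigma>')
    then show ?case using ty[OF octyping.C_Lam[OF C_Lam.hyps]] by simp
  next
    case (C_App \<Gamma> C \<sigma> \<sigma>' D)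
    then show ?case using ty[OF octyping.C_App[OF C_App.hyps]] by simp
  next
    case (C_Fix \<Gamma> C \<sigma>)
    then show ?case using ty[OF octyping.C_Fix[OF C_Fix.hyps]] by simp
  qed simp_all
qed

lemma lift_closed_ge: "\<Gamma> \<turnstile> M : \<sigma> \<Longrightarrow> length \<Gamma> \<le> k \<Longrightarrow> lift M k = M"
  by (induction arbitrary: k rule: typing.induct) auto

lemma lift_closed [simp]: "[] \<turnstile> M : \<sigma> \<Longrightarrow> lift M k = M"
  by (rule lift_closed_ge) auto

lemma subst_closed_ge: "\<Gamma> \<turnstile> M : \<sigma> \<Longrightarrow> length \<Gamma> \<le> k \<Longrightarrow> subst M N k = M"
  by (induction arbitrary: k N rule: typing.induct) auto

text \<open>The variable replaced is the outermost one, and the prefix \<Gamma> collects the binders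
  crossed; a closed \<open>N\<close> survives their lifting unchanged.\<close>

lemma subst_typing:
  assumes "\<Gamma> @ [\<tau>] \<turnstile> M : \<sigma>" and N: "[] \<turnstile> N : \<tau>"
  shows "\<Gamma> \<turnstile> subst M N (length \<Gamma>) : \<sigma>"
  using assms(1)
proof (induction "\<Gamma> @ [\<tau>]" M \<sigma> arbitrary: \<Gamma> rule: typing.induct)
  case (T_Var i \<sigma>)
  then show ?case
    using typing_closed[OF N] by (auto simp: nth_append intro: typing.T_Var split: if_splits)
next
  case (T_Ifz M P \<sigma> R)
  show ?case
    using T_Ifz(2,4) T_Ifz(6)[of "TNat # \<Gamma>"] by (simp add: N lift_closed[OF N] typing.T_Ifz)
next
  case (T_Lam \<sigma> M \<tau>')
  show ?case
    using T_Lam(2)[of "\<sigma> # \<Gamma>"] by (simp add: lift_closed[OF N] typing.T_Lam)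
qed (auto intro: typing.intros)

text \<open>The value of a closed \<open>N\<close> is independent of the environment, so it stays
  one fixed entry at the outer end while the binders crossed accumulate in
  \<open>us\<close>.\<close>

lemma den_subst:
  assumes "\<Gamma> @ [\<tau>] \<turnstile> M : \<sigma>" "us \<in> envs \<Gamma>" and N: "[] \<turnstile> N : \<tau>"
  shows "den \<Gamma> (subst M N (length \<Gamma>)) us = den (\<Gamma> @ [\<tau>]) M (us @ [den [] N []])"
proof -
  have nN: "den [] N [] \<in> pcliques \<tau>" by (rule den_pcliques[OF N]) simp
  have ext: "us @ [den [] N []] \<in> envs (\<Gamma> @ [\<tau>])" if "us \<in> envs \<Gamma>" for us \<Gamma>
    by (rule envs_append[OF that]) (simp add: nN)
  show ?thesis
    using assms(1,2)
  proof (induction "\<Gamma> @ [\<tau>]" M \<sigma> arbitrary: \<Gamma> us rule: typing.induct)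
    case (T_Num n)
    then show ?case by (simp add: den_Num ext)
  next
    case (T_Var i \<sigma>)
    note t = typing.T_Var[OF T_Var.hyps] and l = envs_length[OF T_Var.prems]
    show ?case
    proof (cases "i < length \<Gamma>")
      case True
      then have "\<Gamma> \<turnstile> Var i : \<sigma>" using T_Var.hyps by (auto simp: nth_append intro: typing.T_Var)
      with True show ?thesis
        by (simp add: den_Var[OF t ext[OF T_Var.prems]] den_Var[OF _ T_Var.prems] nth_append l)
    next
      case False
      with T_Var.hyps have "i = length \<Gamma>" by simp
      with den_Var[OF t ext[OF T_Var.prems]] show ?thesis
        by (simp add: nth_append l den_closed[OF N T_Var.prems])
    qed
  next
    case (T_Coin p)
    then show ?case by (simp add: den_Coin ext)
  next
    case (T_Succ M)
    then show ?case by (simp add: den_Succ ext subst_typing[OF _ N])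
  next
    case (T_Ifz M P \<sigma> R)
    have R: "(TNat # \<Gamma>) @ [\<tau>] \<turnstile> R : \<sigma>" using T_Ifz by simp
    have "den (TNat # \<Gamma>) (subst R N (Suc (length \<Gamma>))) (dirac n # us) =
        den (TNat # \<Gamma> @ [\<tau>]) R (dirac n # us @ [den [] N []])" for n
      using T_Ifz(6)[of "TNat # \<Gamma>" "dirac n # us"] T_Ifz(7) dirac_pcliques[of n] by simp
    then show ?case
      using T_Ifz(1-5,7) subst_typing[OF R N]
      by (simp add: den_Ifz[of _ _ _ \<sigma>] ext subst_typing[OF _ N] lift_closed[OF N])
  next
    case (T_Lam \<sigma> M \<tau>')
    have M: "(\<sigma> # \<Gamma>) @ [\<tau>] \<turnstile> M : \<tau>'" using T_Lam by simp
    have M': "\<sigma> # \<Gamma> \<turnstile> subst M N (Suc (length \<Gamma>)) : \<tau>'" using subst_typing[OF M N] by simp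
    have "den \<Gamma> (Lam \<sigma> (subst M N (Suc (length \<Gamma>)))) us =
        den (\<Gamma> @ [\<tau>]) (Lam \<sigma> M) (us @ [den [] N []])"
    proof (rule pcliques_fun_eqI)
      show "den \<Gamma> (Lam \<sigma> (subst M N (Suc (length \<Gamma>)))) us \<in> pcliques (TFun \<sigma> \<tau>')"
        by (intro den_pcliques typing.T_Lam M' T_Lam(3))
      show "den (\<Gamma> @ [\<tau>]) (Lam \<sigma> M) (us @ [den [] N []]) \<in> pcliques (TFun \<sigma> \<tau>')"
        by (intro den_pcliques typing.T_Lam T_Lam(1) ext T_Lam(3))
      fix v assume "v \<in> pcliques \<sigma>"
      then show "fun_hat (den \<Gamma> (Lam \<sigma> (subst M N (Suc (length \<Gamma>)))) us) v =
          fun_hat (den (\<Gamma> @ [\<tau>]) (Lam \<sigma> M) (us @ [den [] N []])) v"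
        using T_Lam(2)[of "\<sigma> # \<Gamma>" "v # us"] T_Lam(3) ext[OF T_Lam(3)]
        by (simp add: fun_hat_den_Lam[OF M'] fun_hat_den_Lam[OF T_Lam(1)])
    qed
    then show ?case by (simp add: lift_closed[OF N])
  next
    case (T_App M \<sigma> \<tau>' P)
    then show ?case by (simp add: den_App[of _ _ \<sigma> \<tau>'] ext subst_typing[OF _ N])
  next
    case (T_Fix M \<sigma>)
    then show ?case by (simp add: den_Fix[of _ _ \<sigma>] ext subst_typing[OF _ N])
  qed
qed

section \<open>Simultaneous substitution of closed terms\<close>

primrec close_tm :: "tm \<Rightarrow> tm list \<Rightarrow> nat \<Rightarrow> tm" where
  "close_tm (Num n) \<theta> k = Num n"
| "close_tm (Var i) \<theta> k = (if i < k then Var i else \<theta> ! (i - k))"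
| "close_tm (Succ M) \<theta> k = Succ (close_tm M \<theta> k)"
| "close_tm (Ifz M P R) \<theta> k = Ifz (close_tm M \<theta> k) (close_tm P \<theta> k) (close_tm R \<theta> (Suc k))"
| "close_tm (Lam \<sigma> M) \<theta> k = Lam \<sigma> (close_tm M \<theta> (Suc k))"
| "close_tm (App M N) \<theta> k = App (close_tm M \<theta> k) (close_tm N \<theta> k)"
| "close_tm (Coin p) \<theta> k = Coin p"
| "close_tm (Fix M) \<theta> k = Fix (close_tm M \<theta> k)"

abbreviation closing :: "tm list \<Rightarrow> ty list \<Rightarrow> bool" where
  "closing \<theta> \<Delta> \<equiv> list_all2 (\<lambda>N \<tau>. [] \<turnstile> N : \<tau>) \<theta> \<Delta>"

lemma close_tm_typing:
  assumes "\<Gamma> @ \<Delta> \<turnstile> M : \<sigma>" "closing \<theta> \<Delta>"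
  shows "\<Gamma> \<turnstile> close_tm M \<theta> (length \<Gamma>) : \<sigma>"
  using assms(1)
proof (induction "\<Gamma> @ \<Delta>" M \<sigma> arbitrary: \<Gamma> rule: typing.induct)
  case (T_Var i \<sigma>)
  show ?case
  proof (cases "i < length \<Gamma>")
    case True
    then show ?thesis using T_Var by (auto simp: nth_append intro: typing.T_Var)
  next
    case False
    then have "[] \<turnstile> \<theta> ! (i - length \<Gamma>) : \<sigma>"
      using T_Var list_all2_nthD2[OF assms(2), of "i - length \<Gamma>"] by (auto simp: nth_append)
    then show ?thesis using False by (simp add: typing_closed)
  qed
next
  case (T_Ifz M P \<sigma> R)
  show ?case using T_Ifz(2,4) T_Ifz(6)[of "TNat # \<Gamma>"] by (simp add: typing.T_Ifz)
next
  case (T_Lam \<sigma> M \<tau>')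
  show ?case using T_Lam(2)[of "\<sigma> # \<Gamma>"] by (simp add: typing.T_Lam)
qed (auto intro: typing.intros)

lemma close_tm_nil: "\<Gamma> \<turnstile> M : \<sigma> \<Longrightarrow> length \<Gamma> \<le> k \<Longrightarrow> close_tm M [] k = M"
  by (induction arbitrary: k rule: typing.induct) auto

text \<open>Closing below a binder and instantiating it afterwards amounts to closing with a longer
  list, because the closed entries of \<theta> are untouched by the substitution. A beta step thus
  matches an extension of the list.\<close>

lemma subst_close_tm:
  assumes "\<Gamma> @ \<tau> # \<Delta> \<turnstile> M : \<sigma>" "closing \<theta> \<Delta>" and N: "[] \<turnstile> N : \<tau>"
  shows "subst (close_tm M \<theta> (Suc (length \<Gamma>))) N (length \<Gamma>) = close_tm M (N # \<theta>) (length \<Gamma>)"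
  using assms(1)
proof (induction "\<Gamma> @ \<tau> # \<Delta>" M \<sigma> arbitrary: \<Gamma> rule: typing.induct)
  case (T_Var i \<sigma>)
  show ?case
  proof (cases "i \<le> length \<Gamma>")
    case True
    then show ?thesis by auto
  next
    case False
    then have "[] \<turnstile> \<theta> ! (i - Suc (length \<Gamma>)) : \<Delta> ! (i - Suc (length \<Gamma>))"
      using T_Var by (intro list_all2_nthD2[OF assms(2)]) simp
    then show ?thesis
      using False by (simp add: subst_closed_ge nth_Cons')
  qed
next
  case (T_Ifz M P \<sigma> R)
  show ?case using T_Ifz(2,4) T_Ifz(6)[of "TNat # \<Gamma>"] by (simp add: lift_closed[OF N])
next
  case (T_Lam \<sigma> M \<tau>')
  show ?case using T_Lam(2)[of "\<sigma> # \<Gamma>"] by (simp add: lift_closed[OF N])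
qed auto

section \<open>Head reduction\<close>

text \<open>
  \<open>nxt M = Some (p, a, b)\<close> says that \<open>M\<close> reduces to \<open>a\<close> with probability \<open>p\<close> and to \<open>b\<close> with
  probability \<open>1 - p\<close>; deterministic steps have \<open>p = 1\<close> and \<open>a = b\<close>.
\<close>

primrec nxt :: "tm \<Rightarrow> (rat \<times> tm \<times> tm) option" where
  "nxt (Num n) = None"
| "nxt (Var i) = None"
| "nxt (Lam \<sigma> M) = None"
| "nxt (Coin p) = Some (p, Num 0, Num 1)"
| "nxt (Fix M) = Some (1, App M (Fix M), App M (Fix M))"
| "nxt (Succ M) = (case nxt M of
      Some (p, a, b) \<Rightarrow> Some (p, Succ a, Succ b)
    | None \<Rightarrow> (case M of Num n \<Rightarrow> Some (1, Num (Suc n), Num (Suc n)) | _ \<Rightarrow> None))"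
| "nxt (Ifz M P R) = (case nxt M of
      Some (p, a, b) \<Rightarrow> Some (p, Ifz a P R, Ifz b P R)
    | None \<Rightarrow> (case M of
        Num n \<Rightarrow> (case n of 0 \<Rightarrow> Some (1, P, P) | Suc m \<Rightarrow> Some (1, subst R (Num m) 0, subst R (Num m) 0))
      | _ \<Rightarrow> None))"
| "nxt (App M N) = (case nxt M of
      Some (p, a, b) \<Rightarrow> Some (p, App a N, App b N)
    | None \<Rightarrow> (case M of Lam \<sigma> B \<Rightarrow> Some (1, subst B N 0, subst B N 0) | _ \<Rightarrow> None))"

text \<open>The second alternative is for deterministic steps, where \<open>nxt\<close> lists a
  branch of probability 0 that \<open>step\<close> lacks. A \<open>Coin 1\<close> does have such a
  branch, so \<open>p = 1\<close> alone does not separate the cases.\<close>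

lemma nxt_step:
  "nxt M = Some (p, a, b) \<Longrightarrow> step M p a \<and> step M (1 - p) b \<or> p = 1 \<and> a = b \<and> step M 1 a"
  by (induction M arbitrary: p a b)
    (auto intro: step.intros step_coin_1[simplified] split: option.splits tm.splits nat.splits)

lemma step_nxt:
  "step M q N \<Longrightarrow> \<exists>p a b. nxt M = Some (p, a, b) \<and> (q = p \<and> N = a \<or> q = 1 - p \<and> N = b \<and> a \<noteq> b)"
  by (induction rule: step.induct) auto

lemma nxt_same: "nxt M = Some (p, a, a) \<Longrightarrow> p = 1"
  by (induction M arbitrary: p a) (auto split: option.splits tm.splits nat.splits)

text \<open>The condition \<open>a \<noteq> b\<close> separates the branches of a coin from a
  deterministic step recorded twice.\<close>

lemma step_iff:
  assumes "nxt M = Some (p, a, b)"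
  shows "step M q N \<longleftrightarrow> q = p \<and> N = a \<or> q = 1 - p \<and> N = b \<and> a \<noteq> b"
  using nxt_step[OF assms] step_nxt[of M q N] assms nxt_same[of M p a] by auto

lemma weak_normal_iff: "weak_normal M \<longleftrightarrow> nxt M = None"
proof (cases "nxt M")
  case None
  then show ?thesis using step_nxt[of M] by (fastforce simp: weak_normal_def)
next
  case (Some x)
  then show ?thesis using nxt_step[of M] by (cases x) (auto simp: weak_normal_def)
qed

lemma Red_None: "nxt M = None \<Longrightarrow> Red M N = (if N = M then 1 else 0)"
  using step_nxt[of M] weak_normal_iff[of M] by (auto simp: Red_def)

text \<open>A row of the matrix as two indicators, which add to 1 + 0 when \<open>a = b\<close>.
  Multiplication by the matrix becomes a recursion with two summands.\<close>

lemma Red_Some: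
  assumes "nxt M = Some (p, a, b)"
  shows "Red M N = (if N = a then ennreal (of_rat p) else 0) +
    (if N = b then ennreal (of_rat (1 - p)) else 0)"
proof -
  have "\<not> weak_normal M" using assms by (simp add: weak_normal_iff)
  moreover have "(THE q. step M q N) = (if N = a then p else 1 - p)" if "N = a \<or> N = b"
    using that unfolding step_iff[OF assms] by (intro the_equality) auto
  moreover have "(\<exists>q. step M q N) \<longleftrightarrow> N = a \<or> N = b"
    unfolding step_iff[OF assms] by auto
  ultimately show ?thesis
    using nxt_same[of M p a] assms by (auto simp: Red_def)
qed

lemma nxt_typing:
  assumes "[] \<turnstile> M : \<sigma>" "nxt M = Some (p, a, b)"
  shows "[] \<turnstile> a : \<sigma> \<and> [] \<turnstile> b : \<sigma> \<and> 0 \<le> p \<and> p \<le> 1"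
  using assms
proof (induction "[] :: ty list" M \<sigma> arbitrary: p a b rule: typing.induct)
  case (T_Coin q)
  then show ?case by (auto intro: T_Num)
next
  case (T_Succ M)
  then show ?case
    by (auto intro: typing.intros split: option.splits tm.splits)
next
  case (T_Ifz M P \<sigma> R)
  show ?case
  proof (cases "nxt M")
    case None
    have "[] \<turnstile> subst R (Num m) 0 : \<sigma>" for m
      using subst_typing[of "[]" TNat R \<sigma> "Num m"] T_Ifz by (simp add: T_Num)
    then show ?thesis
      using None T_Ifz by (auto split: tm.splits nat.splits)
  next
    case (Some x)
    then show ?thesis
      using T_Ifz by (cases x) (auto intro: typing.T_Ifz)
  qed
next
  case (T_App M \<sigma> \<tau> N)
  show ?case
  proof (cases "nxt M")
    case None
    then obtain \<sigma>' B where M: "M = Lam \<sigma>' B" "a = subst B N 0" "b = subst B N 0" "p = 1"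
      using T_App.prems by (auto split: tm.splits)
    with T_App.hyps(1) have "[\<sigma>] \<turnstile> B : \<tau>" by (auto elim: typing_LamE)
    then show ?thesis
      using subst_typing[of "[]" \<sigma> B \<tau> N] T_App.hyps M by simp
  next
    case (Some x)
    then show ?thesis
      using T_App by (cases x) (auto intro: typing.T_App)
  qed
next
  case (T_Fix M \<sigma>)
  then show ?case by (auto intro: typing.intros)
qed auto

section \<open>Soundness\<close>

definition mix :: "rat \<Rightarrow> pvec \<Rightarrow> pvec \<Rightarrow> pvec" where
  "mix p u v = (\<lambda>x. ennreal (of_rat p) * u x + ennreal (of_rat (1 - p)) * v x)"

lemma mix_1 [simp]: "mix 1 u v = u"
  by (simp add: mix_def)

text \<open>The positions in which reduction takes place are interpreted linearly: the function of
  an application, the argument of \<open>Succ\<close>, the guard of a conditional. A one-step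
  mixture therefore passes through them.\<close>

lemma fun_hat_mix: "fun_hat (mix p t s) u = mix p (fun_hat t u) (fun_hat s u)"
  by (simp add: mix_def fun_hat_add fun_hat_cmult)

lemma succ_vec_mix: "succ_vec (mix p u v) = mix p (succ_vec u) (succ_vec v)"
  by (simp add: succ_vec_def mix_def distrib_right mult.assoc infsum_ennreal_add infsum_ennreal_cmult)

lemma ifz_vec_mix: "ifz_vec (mix p u v) q r = mix p (ifz_vec u q r) (ifz_vec v q r)"
  by (simp add: ifz_vec_eq mix_def distrib_right mult.assoc infsum_ennreal_add infsum_ennreal_cmult)

text \<open>Kleene's argument: \<open>fun_hat t\<close> commutes with the supremum of the increasing
  iterates, and dropping iterate 0 leaves it unchanged.\<close>

lemma fun_hat_fix_vec: "fun_hat t (fix_vec t) = fix_vec t"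
proof
  fix b
  let ?s = "\<lambda>n. (fun_hat t ^^ n) (\<lambda>_. 0)"
  have "fun_hat t (fix_vec t) b = (SUP n. ?s (Suc n) b)"
    unfolding fix_vec_apply[abs_def] by (simp add: fun_hat_continuous incseq_fun_hat_iterates)
  also have "\<dots> = (SUP n. ?s n b)"
    using incseq_fun_hat_iterates[of t b]
    by (intro SUP_eq) (auto simp: incseq_Suc_iff intro: exI[of _ "Suc _"])
  finally show "fun_hat t (fix_vec t) b = fix_vec t b" by (simp add: fix_vec_apply)
qed

lemma infsum_dirac_mult: "(\<Sum>\<^sub>\<infinity>n. dirac m (PNat n) * f n) = (f m :: ennreal)"
proof -
  have "(\<Sum>\<^sub>\<infinity>n. dirac m (PNat n) * f n) = (\<Sum>\<^sub>\<infinity>n. if n = m then f n else 0)"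
    by (intro infsum_cong) simp
  then show ?thesis by (simp add: infsum_ennreal_delta)
qed

lemma succ_vec_dirac: "succ_vec (dirac n) = dirac (Suc n)"
  unfolding succ_vec_def infsum_dirac_mult by simp

lemma ifz_vec_dirac: "ifz_vec (dirac n) q r = (case n of 0 \<Rightarrow> q | Suc m \<Rightarrow> r m)"
  unfolding ifz_vec_eq infsum_dirac_mult by simp

abbreviation cden :: "tm \<Rightarrow> pvec" where
  "cden M \<equiv> den [] M []"

lemma cden_beta:
  assumes "[\<sigma>] \<turnstile> M : \<tau>" "[] \<turnstile> N : \<sigma>"
  shows "cden (subst M N 0) = den [\<sigma>] M [cden N]"
  using den_subst[of "[]" \<sigma> M \<tau> "[]" N] assms by simp

lemma cden_nxt:
  assumes "[] \<turnstile> M : \<sigma>" "nxt M = Some (p, a, b)"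
  shows "cden M = mix p (cden a) (cden b)"
  using assms
proof (induction "[] :: ty list" M \<sigma> arbitrary: p a b rule: typing.induct)
  case (T_Coin q)
  then show ?case by (auto simp: den_Coin den_Num coin_vec_def mix_def)
next
  case (T_Succ M)
  show ?case
  proof (cases "nxt M")
    case None
    then show ?thesis
      using T_Succ by (auto simp: den_Succ den_Num succ_vec_dirac split: tm.splits)
  next
    case (Some x)
    obtain q c d where x: "x = (q, c, d)" by (cases x)
    then have "p = q" "a = Succ c" "b = Succ d" using Some T_Succ.prems by auto
    then show ?thesis
      using T_Succ nxt_typing[OF T_Succ.hyps(1)] Some x by (simp add: den_Succ succ_vec_mix)
  qed
next
  case (T_Ifz M P \<sigma> R)
  show ?case
  proof (cases "nxt M")
    case None
    then obtain n where M: "M = Num n" and p: "p = 1"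
      and a: "a = (case n of 0 \<Rightarrow> P | Suc m \<Rightarrow> subst R (Num m) 0)"
      using T_Ifz.prems by (auto split: tm.splits nat.splits)
    \<comment> \<open>The numeral put into the branch has as value the Dirac vector at which the
      semantics evaluates this branch.\<close>
    have "cden (subst R (Num m) 0) = den [TNat] R [dirac m]" for m
      using cden_beta[of TNat R \<sigma> "Num m"] T_Ifz by (simp add: T_Num den_Num)
    then show ?thesis
      using T_Ifz M by (simp add: p a den_Ifz den_Num ifz_vec_dirac split: nat.split)
  next
    case (Some x)
    obtain q c d where x: "x = (q, c, d)" by (cases x)
    then have "p = q" "a = Ifz c P R" "b = Ifz d P R" using Some T_Ifz.prems by auto
    then show ?thesis
      using T_Ifz nxt_typing[OF T_Ifz.hyps(1)] Some x by (simp add: den_Ifz ifz_vec_mix)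
  qed
next
  case (T_App M \<sigma> \<tau> N)
  show ?case
  proof (cases "nxt M")
    case None
    then obtain \<sigma>' B where M: "M = Lam \<sigma>' B" "a = subst B N 0" "b = subst B N 0" "p = 1"
      using T_App.prems by (auto split: tm.splits)
    with T_App.hyps(1) have B: "[\<sigma>] \<turnstile> B : \<tau>" "\<sigma>' = \<sigma>" by (auto elim: typing_LamE)
    show ?thesis
      using T_App.hyps(1,3)
      by (simp add: M den_App[of _ _ \<sigma> \<tau>] cden_beta[OF B(1)] fun_hat_den_Lam[OF B(1)] B(2))
  next
    case (Some x)
    obtain q c d where x: "x = (q, c, d)" by (cases x)
    then have "p = q" "a = App c N" "b = App d N" using Some T_App.prems by auto
    then show ?thesis
      using T_App nxt_typing[OF T_App.hyps(1)] Some x by (simp add: den_App[of _ _ \<sigma> \<tau>] fun_hat_mix)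
  qed
next
  case (T_Fix M \<sigma>)
  then show ?case
    by (auto simp: den_Fix den_App[of _ _ \<sigma> \<sigma>] typing.T_Fix fun_hat_fix_vec)
qed auto

section \<open>Convergence probabilities after finitely many steps\<close>

definition prob :: "nat \<Rightarrow> tm \<Rightarrow> nat \<Rightarrow> ennreal" where
  "prob n M m = mat_pow (closed_terms TNat) Red n M (Num m)"

lemma prob_0: "prob 0 M m = (if M = Num m then 1 else 0)"
  by (simp add: prob_def)

text \<open>A normal form loops with probability 1; stage \<open>n\<close> hence counts computations
  of at most \<open>n\<close> steps.\<close>

lemma prob_Suc_None: "nxt M = None \<Longrightarrow> [] \<turnstile> M : TNat \<Longrightarrow> prob (Suc n) M m = prob n M m"
proof -
  assume M: "nxt M = None" "[] \<turnstile> M : TNat"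
  have "prob (Suc n) M m = (\<Sum>\<^sub>\<infinity>k\<in>closed_terms TNat. if k = M then prob n k m else 0)"
    unfolding prob_def by (simp, rule infsum_cong) (simp add: Red_None[OF M(1)])
  then show ?thesis
    using M(2) by (simp add: infsum_ennreal_delta closed_terms_def)
qed

lemma prob_Suc_Some:
  assumes "nxt M = Some (p, a, b)" "[] \<turnstile> M : TNat"
  shows "prob (Suc n) M m = ennreal (of_rat p) * prob n a m + ennreal (of_rat (1 - p)) * prob n b m"
proof -
  let ?p = "ennreal (of_rat p)" and ?q = "ennreal (of_rat (1 - p))"
  have "prob (Suc n) M m = (\<Sum>\<^sub>\<infinity>k\<in>closed_terms TNat.
      (if k = a then ?p * prob n k m else 0) + (if k = b then ?q * prob n k m else 0))"
    unfolding prob_def by (simp, rule infsum_cong) (simp add: Red_Some[OF assms(1)] distrib_right)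
  then show ?thesis
    using nxt_typing[OF assms(2,1)]
    by (simp add: infsum_ennreal_add infsum_ennreal_delta closed_terms_def)
qed

lemma prob_le_cden: "[] \<turnstile> M : TNat \<Longrightarrow> prob n M m \<le> cden M (PNat m)"
proof (induction n arbitrary: M)
  case 0
  then show ?case by (simp add: prob_0 den_Num)
next
  case (Suc n)
  show ?case
  proof (cases "nxt M")
    case None
    then show ?thesis using Suc by (simp add: prob_Suc_None)
  next
    case (Some x)
    obtain p a b where x: "x = (p, a, b)" by (cases x)
    show ?thesis
      using Some x Suc nxt_typing[OF Suc.prems, of p a b]
      by (simp add: prob_Suc_Some cden_nxt[of M TNat p a b] mix_def add_mono mult_left_mono)
  qed
qed

lemma prob_Suc_mono: "[] \<turnstile> M : TNat \<Longrightarrow> prob n M m \<le> prob (Suc n) M m"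
proof (induction n arbitrary: M)
  case 0
  then show ?case by (auto simp: prob_0 prob_Suc_None)
next
  case (Suc n)
  show ?case
  proof (cases "nxt M")
    case None
    then show ?thesis using Suc by (simp add: prob_Suc_None)
  next
    case (Some x)
    obtain p a b where x: "x = (p, a, b)" by (cases x)
    show ?thesis
      using Some x Suc nxt_typing[OF Suc.prems, of p a b]
      by (simp add: prob_Suc_Some[of M p a b] add_mono mult_left_mono del: mat_pow.simps)
  qed
qed

lemma prob_incseq: "[] \<turnstile> M : TNat \<Longrightarrow> incseq (\<lambda>n. prob n M m)"
  by (rule incseq_SucI) (rule prob_Suc_mono)

section \<open>Adequacy\<close>

definition conv_prob :: "tm \<Rightarrow> nat \<Rightarrow> ennreal" where
  "conv_prob M m = (SUP n. prob n M m)"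

lemma Red_inf_eq: "Red_inf TNat M (Num m) = conv_prob M m"
proof -
  have "Num m \<in> stationary (closed_terms TNat) Red"
    by (simp add: stationary_def closed_terms_def T_Num Red_None)
  then show ?thesis by (simp add: Red_inf_def mat_inf_def conv_prob_def prob_def)
qed

lemma prob_le_conv_prob: "prob n M m \<le> conv_prob M m"
  unfolding conv_prob_def by (rule SUP_upper) simp

lemma conv_prob_step:
  assumes "nxt M = Some (1, a, a)" "[] \<turnstile> M : TNat"
  shows "conv_prob a m \<le> conv_prob M m"
  unfolding conv_prob_def[of a]
proof (rule SUP_least)
  fix n
  have "prob n a m = prob (Suc n) M m" by (simp add: prob_Suc_Some[OF assms])
  then show "prob n a m \<le> conv_prob M m" by (simp add: prob_le_conv_prob)
qed

text \<open>Evaluation contexts, characterised by their effect on \<open>nxt\<close>: closure under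
  a further application is then immediate, at every type.\<close>

definition head_context :: "(tm \<Rightarrow> tm) \<Rightarrow> bool" where
  "head_context E \<longleftrightarrow> (\<forall>M p a b. nxt M = Some (p, a, b) \<longrightarrow> nxt (E M) = Some (p, E a, E b))"

lemma head_contextD: "head_context E \<Longrightarrow> nxt M = Some (p, a, b) \<Longrightarrow> nxt (E M) = Some (p, E a, E b)"
  by (simp add: head_context_def)

text \<open>Running \<open>M\<close> to a numeral within \<open>k\<close> steps and the filled
  context within \<open>j\<close> more takes at most \<open>k + j\<close> steps. The induction
  follows the reduction of \<open>M\<close>, which the context copies.\<close>

lemma prob_head_context:
  assumes E: "head_context E" "\<And>M. [] \<turnstile> M : TNat \<Longrightarrow> [] \<turnstile> E M : TNat"
    and "[] \<turnstile> M : TNat"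
  shows "(\<Sum>\<^sub>\<infinity>m. prob k M m * prob j (E (Num m)) n) \<le> prob (k + j) (E M) n"
  using assms(3)
proof (induction k arbitrary: M)
  case 0
  show ?case
  proof (cases "\<exists>i. M = Num i")
    case True
    then obtain i where i: "M = Num i" ..
    have "(\<Sum>\<^sub>\<infinity>m. prob 0 M m * prob j (E (Num m)) n) =
        (\<Sum>\<^sub>\<infinity>m. if m = i then prob j (E (Num m)) n else 0)"
      by (intro infsum_cong) (auto simp: prob_0 i)
    then show ?thesis by (simp add: infsum_ennreal_delta i)
  qed (simp add: prob_0)
next
  case (Suc k)
  show ?case
  proof (cases "nxt M")
    case None
    \<comment> \<open>A normal \<open>M\<close> wastes a stage, which monotonicity in the stage
      absorbs.\<close>
    have "(\<Sum>\<^sub>\<infinity>m. prob (Suc k) M m * prob j (E (Num m)) n) \<le> prob (k + j) (E M) n"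
      using Suc by (simp add: prob_Suc_None[OF None])
    also have "\<dots> \<le> prob (Suc (k + j)) (E M) n"
      by (intro prob_Suc_mono E(2) Suc.prems)
    finally show ?thesis by simp
  next
    case (Some x)
    obtain p a b where "x = (p, a, b)" by (cases x)
    with Some have M: "nxt M = Some (p, a, b)" by simp
    note ab = nxt_typing[OF Suc.prems M]
    let ?p = "ennreal (of_rat p)" and ?q = "ennreal (of_rat (1 - p))"
    have "(\<Sum>\<^sub>\<infinity>m. prob (Suc k) M m * prob j (E (Num m)) n) =
        ?p * (\<Sum>\<^sub>\<infinity>m. prob k a m * prob j (E (Num m)) n) + ?q * (\<Sum>\<^sub>\<infinity>m. prob k b m * prob j (E (Num m)) n)"
      by (simp add: prob_Suc_Some[OF M Suc.prems] distrib_right mult.assoc infsum_ennreal_add infsum_ennreal_cmult)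
    also have "\<dots> \<le> ?p * prob (k + j) (E a) n + ?q * prob (k + j) (E b) n"
      using ab by (intro add_mono mult_left_mono Suc.IH) auto
    also have "\<dots> = prob (Suc (k + j)) (E M) n"
      by (rule prob_Suc_Some[OF head_contextD[OF E(1) M] E(2)[OF Suc.prems], symmetric])
    finally show ?thesis by simp
  qed
qed

text \<open>The suprema over the two stages are taken along the diagonal, where the finite bound
  applies with stage \<open>k + k\<close>.\<close>

lemma conv_prob_head_context:
  assumes E: "head_context E" "\<And>M. [] \<turnstile> M : TNat \<Longrightarrow> [] \<turnstile> E M : TNat"
    and M: "[] \<turnstile> M : TNat"
  shows "(\<Sum>\<^sub>\<infinity>m. conv_prob M m * conv_prob (E (Num m)) n) \<le> conv_prob (E M) n"
proof -
  have inc: "incseq (\<lambda>k. prob k M m)" "incseq (\<lambda>k. prob k (E (Num m)) n)" for m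
    by (intro prob_incseq M E(2) T_Num)+
  have "(\<Sum>\<^sub>\<infinity>m. conv_prob M m * conv_prob (E (Num m)) n) =
      (\<Sum>\<^sub>\<infinity>m. SUP k. prob k M m * prob k (E (Num m)) n)"
    unfolding conv_prob_def by (intro infsum_cong SUP_mult_SUP_ennreal inc)
  also have "\<dots> = (SUP k. \<Sum>\<^sub>\<infinity>m. prob k M m * prob k (E (Num m)) n)"
    using inc by (intro infsum_ennreal_SUP_seq) (auto simp: incseq_def intro!: mult_mono)
  also have "\<dots> \<le> conv_prob (E M) n"
    by (rule SUP_least) (rule order_trans[OF prob_head_context[OF E M] prob_le_conv_prob])
  finally show ?thesis .
qed

text \<open>Related arguments are closed, typed and cliques: what is required to extend the closing
  list and the environment when an abstraction is applied.\<close>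

primrec computes :: "ty \<Rightarrow> tm \<Rightarrow> pvec \<Rightarrow> bool" where
  "computes TNat M u \<longleftrightarrow> (\<forall>n. u (PNat n) \<le> conv_prob M n)"
| "computes (TFun \<sigma> \<tau>) M t \<longleftrightarrow>
    (\<forall>N u. [] \<turnstile> N : \<sigma> \<longrightarrow> u \<in> pcliques \<sigma> \<longrightarrow> computes \<sigma> N u \<longrightarrow> computes \<tau> (App M N) (fun_hat t u))"

lemma computes_zero: "computes \<sigma> M (\<lambda>_. 0)"
  by (induction \<sigma> arbitrary: M) simp_all

lemma computes_SUP:
  assumes "\<And>a. incseq (\<lambda>n. u n a)" "\<And>n. computes \<sigma> M (u n)"
  shows "computes \<sigma> M (\<lambda>a. SUP n. u n a)"
  using assms
proof (induction \<sigma> arbitrary: M u)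
  case TNat
  then show ?case by (auto intro: SUP_least)
next
  case (TFun \<sigma> \<tau>)
  have "computes \<tau> (App M N) (\<lambda>b. SUP n. fun_hat (u n) v b)"
    if "[] \<turnstile> N : \<sigma>" "v \<in> pcliques \<sigma>" "computes \<sigma> N v" for N v
  proof (rule TFun.IH(2))
    show "incseq (\<lambda>n. fun_hat (u n) v b)" for b
      using TFun.prems(1) by (auto simp: incseq_def intro: fun_hat_mono)
    show "computes \<tau> (App M N) (fun_hat (u n) v)" for n
      using TFun.prems(2)[of n] that by simp
  qed
  then show ?case by (simp add: fun_hat_SUP TFun.prems(1))
qed

text \<open>At a function type the step of \<open>M\<close> becomes a step of
  \<open>App M N\<close>, down to type nat. Only deterministic steps are expanded; randomness enters
  through the value of a coin and through \<open>computes_head_context\<close>.\<close>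

lemma computes_step:
  assumes "[] \<turnstile> M : \<sigma>" "nxt M = Some (1, a, a)" "computes \<sigma> a u"
  shows "computes \<sigma> M u"
  using assms
proof (induction \<sigma> arbitrary: M a u rule: ty.induct)
  case TNat
  then show ?case using conv_prob_step[OF TNat(2,1)] by (auto intro: order_trans)
next
  case (TFun \<sigma> \<tau>)
  have "computes \<tau> (App M N) (fun_hat u v)"
    if "[] \<turnstile> N : \<sigma>" "v \<in> pcliques \<sigma>" "computes \<sigma> N v" for N v
    by (rule TFun.IH(2)[of _ "App a N"])
      (use TFun.prems that in \<open>auto intro: T_App\<close>)
  then show ?case by simp
qed

text \<open>Each argument supplied is absorbed into the context \<open>E\<close>, until at type nat
  the convergence probabilities compose. Linearity of \<open>fun_hat\<close> in the function keeps
  the weights \<open>u\<close> outside.\<close>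

lemma computes_head_context:
  assumes "head_context E" "\<And>M. [] \<turnstile> M : TNat \<Longrightarrow> [] \<turnstile> E M : \<sigma>"
    and "[] \<turnstile> M : TNat" "\<And>m. u m \<le> conv_prob M m" "\<And>m. computes \<sigma> (E (Num m)) (v m)"
  shows "computes \<sigma> (E M) (\<lambda>a. \<Sum>\<^sub>\<infinity>m. u m * v m a)"
  using assms(1,2,5)
proof (induction \<sigma> arbitrary: E v)
  case TNat
  have "(\<Sum>\<^sub>\<infinity>m. u m * v m (PNat n)) \<le> conv_prob (E M) n" for n
  proof -
    have "(\<Sum>\<^sub>\<infinity>m. u m * v m (PNat n)) \<le> (\<Sum>\<^sub>\<infinity>m. conv_prob M m * conv_prob (E (Num m)) n)"
      using TNat.prems(3) by (intro infsum_ennreal_mono mult_mono assms(4)) auto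
    also have "\<dots> \<le> conv_prob (E M) n"
      by (rule conv_prob_head_context[OF TNat.prems(1,2) assms(3)])
    finally show ?thesis .
  qed
  then show ?case by simp
next
  case (TFun \<sigma> \<tau>)
  have "computes \<tau> (App (E M) N) (\<lambda>b. \<Sum>\<^sub>\<infinity>m. u m * fun_hat (v m) w b)"
    if "[] \<turnstile> N : \<sigma>" "w \<in> pcliques \<sigma>" "computes \<sigma> N w" for N w
  proof (rule TFun.IH(2)[of "\<lambda>M. App (E M) N"])
    show "head_context (\<lambda>M. App (E M) N)"
      using TFun.prems(1) by (simp add: head_context_def)
    show "[] \<turnstile> App (E M) N : \<tau>" if "[] \<turnstile> M : TNat" for M
      by (rule T_App[OF TFun.prems(2)[OF that] \<open>[] \<turnstile> N : \<sigma>\<close>])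
    show "computes \<tau> (App (E (Num m)) N) (fun_hat (v m) w)" for m
      using TFun.prems(3)[of m] that by simp
  qed
  then show ?case by (simp add: fun_hat_infsum)
qed

lemma computes_Num: "computes TNat (Num n) (dirac n)"
  using prob_le_conv_prob[of 0 "Num n" n] by (simp add: prob_0)

lemma computes_Coin:
  assumes "0 \<le> p" "p \<le> 1"
  shows "computes TNat (Coin p) (coin_vec p)"
proof -
  have "coin_vec p (PNat m) = prob (Suc 0) (Coin p) m" for m
    by (subst prob_Suc_Some[of _ p "Num 0" "Num 1"])
      (auto simp: coin_vec_def prob_0 intro: T_Coin assms)
  then show ?thesis by (simp add: prob_le_conv_prob)
qed

lemma computes_Succ:
  assumes "[] \<turnstile> M : TNat" "computes TNat M u"
  shows "computes TNat (Succ M) (succ_vec u)"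
  unfolding succ_vec_def
proof (rule computes_head_context[where E = Succ, OF _ _ assms(1)])
  show "head_context Succ" by (simp add: head_context_def)
  show "computes TNat (Succ (Num m)) (dirac (m + 1))" for m
    by (rule computes_step[OF _ _ computes_Num]) (auto intro: typing.intros)
qed (use assms in \<open>auto intro: T_Succ\<close>)

lemma computes_Ifz:
  assumes "[] \<turnstile> M : TNat" "[] \<turnstile> P : \<sigma>" "[TNat] \<turnstile> R : \<sigma>"
    and "computes TNat M u" "computes \<sigma> P q" "\<And>n. computes \<sigma> (subst R (Num n) 0) (r n)"
  shows "computes \<sigma> (Ifz M P R) (ifz_vec u q r)"
  unfolding ifz_vec_eq
proof (rule computes_head_context[where E = "\<lambda>M. Ifz M P R", OF _ _ assms(1)])
  show "head_context (\<lambda>M. Ifz M P R)" by (simp add: head_context_def)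
  show "computes \<sigma> (Ifz (Num m) P R) (case m of 0 \<Rightarrow> q | Suc m \<Rightarrow> r m)" for m
    by (rule computes_step[where a = "case m of 0 \<Rightarrow> P | Suc m \<Rightarrow> subst R (Num m) 0"])
      (use assms in \<open>auto intro: typing.intros split: nat.split\<close>)
qed (use assms in \<open>auto intro: T_Ifz\<close>)

text \<open>Stated for open terms under any related closing list and environment, so that the
  induction passes under the binders of abstractions and conditionals.\<close>

lemma computes_den:
  assumes "\<Gamma> \<turnstile> M : \<sigma>" "closing \<theta> \<Gamma>" "us \<in> envs \<Gamma>"
    and "\<And>i. i < length \<Gamma> \<Longrightarrow> computes (\<Gamma> ! i) (\<theta> ! i) (us ! i)"
  shows "computes \<sigma> (close_tm M \<theta> 0) (den \<Gamma> M us)"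
  using assms
proof (induction arbitrary: \<theta> us rule: typing.induct)
  case (T_Num \<Gamma> n)
  then show ?case using computes_Num by (simp add: den_Num del: computes.simps)
next
  case (T_Var i \<Gamma> \<sigma>)
  then show ?case using den_Var[OF typing.T_Var[OF T_Var.hyps] T_Var.prems(2)] by auto
next
  case (T_Coin p \<Gamma>)
  then show ?case using computes_Coin by (simp add: den_Coin del: computes.simps)
next
  case (T_Succ \<Gamma> M)
  have "[] \<turnstile> close_tm M \<theta> 0 : TNat"
    using close_tm_typing[of "[]" \<Gamma> M TNat \<theta>] T_Succ by simp
  then show ?case
    using computes_Succ T_Succ by (simp add: den_Succ del: computes.simps)
next
  case (T_Ifz \<Gamma> M P \<sigma> R)
  have R: "[TNat] \<turnstile> close_tm R \<theta> (Suc 0) : \<sigma>"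
    using close_tm_typing[of "[TNat]" \<Gamma> R \<sigma> \<theta>] T_Ifz.hyps T_Ifz.prems by simp
  have MP: "[] \<turnstile> close_tm M \<theta> 0 : TNat" "[] \<turnstile> close_tm P \<theta> 0 : \<sigma>"
    using close_tm_typing[of "[]" \<Gamma> _ _ \<theta>] T_Ifz.hyps T_Ifz.prems by simp_all
  have "computes \<sigma> (subst (close_tm R \<theta> (Suc 0)) (Num n) 0) (den (TNat # \<Gamma>) R (dirac n # us))" for n
  proof -
    have "subst (close_tm R \<theta> (Suc 0)) (Num n) 0 = close_tm R (Num n # \<theta>) 0"
      using subst_close_tm[of "[]" TNat \<Gamma> R \<sigma> \<theta> "Num n"] T_Ifz.hyps T_Ifz.prems by (simp add: T_Num)
    moreover have "computes \<sigma> (close_tm R (Num n # \<theta>) 0) (den (TNat # \<Gamma>) R (dirac n # us))"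
      by (rule T_Ifz.IH(3))
        (use T_Ifz.prems computes_Num[of n] dirac_pcliques[of n] in
          \<open>auto simp: T_Num nth_Cons simp del: computes.simps pcliques.simps split: nat.split\<close>)
    ultimately show ?thesis by simp
  qed
  then show ?case
    using T_Ifz.IH(1,2)[OF T_Ifz.prems]
    by (simp add: den_Ifz[OF T_Ifz.hyps T_Ifz.prems(2)] computes_Ifz[OF MP R] del: computes.simps)
next
  case (T_Lam \<sigma> \<Gamma> M \<tau>)
  have M: "[\<sigma>] \<turnstile> close_tm M \<theta> (Suc 0) : \<tau>"
    using close_tm_typing[of "[\<sigma>]" \<Gamma> M \<tau> \<theta>] T_Lam.hyps T_Lam.prems by simp
  \<comment> \<open>A beta step leads to the body closed by the longer list; head expansion returns
    to the application.\<close>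
  have "computes \<tau> (App (Lam \<sigma> (close_tm M \<theta> (Suc 0))) N) (den (\<sigma> # \<Gamma>) M (u # us))"
    if N: "[] \<turnstile> N : \<sigma>" "u \<in> pcliques \<sigma>" "computes \<sigma> N u" for N u
  proof (rule computes_step)
    show "[] \<turnstile> App (Lam \<sigma> (close_tm M \<theta> (Suc 0))) N : \<tau>"
      by (rule T_App[OF typing.T_Lam[OF M] N(1)])
    have "subst (close_tm M \<theta> (Suc 0)) N 0 = close_tm M (N # \<theta>) 0"
      using subst_close_tm[of "[]" \<sigma> \<Gamma> M \<tau> \<theta> N] T_Lam.hyps T_Lam.prems N by simp
    then show "nxt (App (Lam \<sigma> (close_tm M \<theta> (Suc 0))) N) =
        Some (1, close_tm M (N # \<theta>) 0, close_tm M (N # \<theta>) 0)"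
      by simp
    show "computes \<tau> (close_tm M (N # \<theta>) 0) (den (\<sigma> # \<Gamma>) M (u # us))"
      by (rule T_Lam.IH) (use T_Lam.prems N in \<open>auto simp: nth_Cons split: nat.split\<close>)
  qed
  then show ?case
    by (simp add: fun_hat_den_Lam[OF T_Lam.hyps T_Lam.prems(2)])
next
  case (T_App \<Gamma> M \<sigma> \<tau> N)
  have "[] \<turnstile> close_tm N \<theta> 0 : \<sigma>"
    using close_tm_typing[of "[]" \<Gamma> N \<sigma> \<theta>] T_App.hyps T_App.prems by simp
  moreover have "den \<Gamma> N us \<in> pcliques \<sigma>"
    by (rule den_pcliques[OF T_App.hyps(2) T_App.prems(2)])
  ultimately show ?case
    using T_App.IH(1)[OF T_App.prems] T_App.IH(2)[OF T_App.prems]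
    by (simp add: den_App[OF T_App.hyps T_App.prems(2)])
next
  case (T_Fix \<Gamma> M \<sigma>)
  let ?M = "close_tm M \<theta> 0" and ?t = "den \<Gamma> M us"
  have M: "[] \<turnstile> ?M : TFun \<sigma> \<sigma>"
    using close_tm_typing[of "[]" \<Gamma> M "TFun \<sigma> \<sigma>" \<theta>] T_Fix.hyps T_Fix.prems by simp
  have t: "?t \<in> pcliques (TFun \<sigma> \<sigma>)"
    by (rule den_pcliques[OF T_Fix.hyps T_Fix.prems(2)])
  \<comment> \<open>Each iterate costs one unfolding of \<open>Fix ?M\<close>. Iterate 0 is related
    to every term, and the supremum is taken with the term fixed.\<close>
  have "computes \<sigma> (Fix ?M) ((fun_hat ?t ^^ n) (\<lambda>_. 0))" for n
  proof (induction n)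
    case 0
    show ?case by (simp add: computes_zero)
  next
    case (Suc n)
    have "computes \<sigma> (App ?M (Fix ?M)) (fun_hat ?t ((fun_hat ?t ^^ n) (\<lambda>_. 0)))"
      using T_Fix.IH[OF T_Fix.prems] Suc fun_hat_iterate_pcliques[OF t] typing.T_Fix[OF M] by simp
    then show ?case
      by (intro computes_step[of "Fix ?M" \<sigma> "App ?M (Fix ?M)"]) (simp_all add: typing.T_Fix[OF M])
  qed
  then have "computes \<sigma> (Fix ?M) (fix_vec ?t)"
    unfolding fix_vec_apply[abs_def] by (rule computes_SUP[OF incseq_fun_hat_iterates])
  then show ?case
    by (simp add: den_Fix[OF T_Fix.hyps T_Fix.prems(2)])
qed

lemma adequacy:
  assumes "[] \<turnstile> M : TNat"
  shows "Red_inf TNat M (Num m) = cden M (PNat m)"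
proof -
  have "computes TNat (close_tm M [] 0) (cden M)"
    by (rule computes_den[OF assms]) auto
  then have "cden M (PNat m) \<le> conv_prob M m"
    by (simp add: close_tm_nil[OF assms])
  moreover have "conv_prob M m \<le> cden M (PNat m)"
    unfolding conv_prob_def by (rule SUP_least) (rule prob_le_cden[OF assms])
  ultimately show ?thesis by (simp add: Red_inf_eq)
qed

theorem mainTheorem2:
  fixes \<Gamma> :: "ty list" and \<sigma> :: ty and M M' :: tm
  assumes "\<Gamma> \<turnstile> M : \<sigma>"
    and "\<Gamma> \<turnstile> M' : \<sigma>"
    and "sem \<Gamma> M = sem \<Gamma> M'"
  shows "obs_equiv \<Gamma> \<sigma> M M'"
  unfolding obs_equiv_def
proof (intro allI impI)
  fix C assume C: "octyping \<Gamma> \<sigma> [] C TNat"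
  \<comment> \<open>A closed term denotes the value of its family at the empty environment.\<close>
  have "cden (fill C M) = cden (fill C M')"
    unfolding den_def sem_fill_cong[OF C assms] ..
  then show "Red_inf TNat (fill C M) (Num 0) = Red_inf TNat (fill C M') (Num 0)"
    by (simp add: adequacy fill_typing[OF C assms(1)] fill_typing[OF C assms(2)])
qed

end
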